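(* Assume that $f$ is differentiable on $X$ and that for some $M_1>0$, $M_2>0$ and all $x\in X$ one has $$\mathbf{E}\Big[e^{(F(x,\xi)-f(x))^2/M_1^2}\Big]\le e,\qquad \mathbf{E}\Big[e^{L^2(x,\xi)/M_2^2}\Big]\le e .$$ Define $$a(\mu,N)=\frac{\mu M_1}{\sqrt N},\qquad b(\mu,s,\lambda,N)=\frac{\mu M_1+\left[\Omega(1+s^2)+2\lambda\right]M_2R}{\sqrt N}.$$ Then for all positive integers $N$ and all $\mu\in[0,2\sqrt{\tau_*N}]$, $$\mathrm{Prob}\Big\{\mathrm{Opt}_N(\xi^N)>\mathrm{Opt}+a(\mu,N)\Big\}\le e^{-\frac{\mu^2}{4\tau_*}},$$ and for all positive integers $N$, all $\mu\in[0,2\sqrt{\tau_*N}]$, $s>1$ and $\lambda\ge 0$, $$\mathrm{Prob}\Big\{\mathrm{Opt}_N(\xi^N)<\mathrm{Opt}-b(\mu,s,\lambda,N)\Big\}\le e^{-N(s^2-1)}+e^{-\frac{\mu^2}{4\tau_*}}+e^{-\frac{\lambda^2}{4\tau_*}} .$$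
   Context: $E$ is a Euclidean space, $\|\cdot\|$ a norm on $E$ (not necessarily the Euclidean one), $B_{\|\cdot\|}$ its unit ball, and $\|y\|_*=\max_{\|x\|\le1}\langle x,y\rangle$ the conjugate norm. $\omega$ is a function continuously differentiable on $B_{\|\cdot\|}$, strongly convex with parameter one with respect to $\|\cdot\|$, i.e. $\langle\nabla\omega(x)-\nabla\omega(y),x-y\rangle\ge\|x-y\|^2$ for all $x,y\in B_{\|\cdot\|}$, and with $\omega(0)=0$, $\omega'(0)=0$. Set $\Omega=\max_{\|x\|\le1}\sqrt{2\omega(x)}$. $X\subset E$ is a nonempty convex compact set, and $R$ is the smallest radius of a $\|\cdot\|$-ball containing $X$. $P$ is a Borel probability distribution on $\mathbf{R}^k$ with support $\Xi$, $\xi\sim P$, and $F:E\times\Xi\to\mathbf{R}$ is a Borel function, convex in $x\in E$ and such that $F(x,\cdot)$ is $P$-summable for every $x\in E$. Set $f(x)=\mathbf{E}\{F(x,\xi)\}$ (a convex function on $E$) and $$L(x,\xi)=\max\{\|g-h\|_*:\ g\in\partial_xF(x,\xi),\ h\in\partial f(x)\}.$$ Let $\mathrm{Opt}=\min_{x\in X}f(x)$ and $\mathrm{Opt}_N(\xi^N)=\min_{x\in X}\frac1N\sum_{t=1}^NF(x,\xi_t)$, where $\xi^N=(\xi_1,\dots,\xi_N)$ and $\xi_1,\xi_2,\dots$ are drawn independently from $P$. $\tau_*=0.557409\ldots$ is the smallest positive real such that $e^t\le t+e^{\tau_*t^2}$ for all $t\in\mathbf{R}$. *)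

theory Defs
  imports "HOL-Probability.Probability"
begin

(* All minima and maxima below are written as Inf/Sup.  Under the hypotheses of the theorem
   they are taken of continuous functions over nonempty compact sets, or of closed nonempty sets
   of reals that are bounded on the relevant side, and hence are attained. *)

definition is_norm :: "('a::real_vector \<Rightarrow> real) \<Rightarrow> bool" where
  "is_norm nrm \<longleftrightarrow>
     (\<forall>x. 0 \<le> nrm x) \<and>
     (\<forall>x. nrm x = 0 \<longleftrightarrow> x = 0) \<and>
     (\<forall>c x. nrm (c *\<^sub>R x) = \<bar>c\<bar> * nrm x) \<and>
     (\<forall>x y. nrm (x + y) \<le> nrm x + nrm y)"

definition nball :: "('a::real_vector \<Rightarrow> real) \<Rightarrow> 'a \<Rightarrow> real \<Rightarrow> 'a set" where
  "nball nrm c r = {x. nrm (x - c) \<le> r}"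

definition conj_norm :: "('a::euclidean_space \<Rightarrow> real) \<Rightarrow> 'a \<Rightarrow> real" where
  "conj_norm nrm y = (SUP x\<in>nball nrm 0 1. inner x y)"

(* \<omega> is only looked at on the unit ball.  The ball is convex with nonempty interior, so the
   gradient relative to the ball is unique at each of its points, boundary points included. *)
definition distance_generating :: "('a::euclidean_space \<Rightarrow> real) \<Rightarrow> ('a \<Rightarrow> real) \<Rightarrow> bool" where
  "distance_generating nrm \<omega> \<longleftrightarrow>
     (\<exists>grad. (\<forall>x\<in>nball nrm 0 1.
               (\<omega> has_derivative (\<lambda>h. inner (grad x) h)) (at x within nball nrm 0 1)) \<and>
             continuous_on (nball nrm 0 1) grad \<and>
             (\<forall>x\<in>nball nrm 0 1. \<forall>y\<in>nball nrm 0 1.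
               inner (grad x - grad y) (x - y) \<ge> (nrm (x - y))\<^sup>2) \<and>
             \<omega> 0 = 0 \<and> grad 0 = 0)"

definition Omega :: "('a::euclidean_space \<Rightarrow> real) \<Rightarrow> ('a \<Rightarrow> real) \<Rightarrow> real" where
  "Omega nrm \<omega> = (SUP x\<in>nball nrm 0 1. sqrt (2 * \<omega> x))"

definition min_radius :: "('a::real_vector \<Rightarrow> real) \<Rightarrow> 'a set \<Rightarrow> real" where
  "min_radius nrm X = Inf {r. 0 \<le> r \<and> (\<exists>c. X \<subseteq> nball nrm c r)}"

definition supp :: "'b::topological_space measure \<Rightarrow> 'b set" where
  "supp P = {z. \<forall>U. open U \<longrightarrow> z \<in> U \<longrightarrow> emeasure P U > 0}"

(* The integrand F x is only meaningful on supp P, which carries the whole mass of P;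
   its values elsewhere are ignored. *)
definition expected :: "'b::topological_space measure \<Rightarrow> ('a \<Rightarrow> 'b \<Rightarrow> real) \<Rightarrow> 'a \<Rightarrow> real" where
  "expected P F x = (LINT z:supp P|P. F x z)"

definition subdifferential :: "('a::real_inner \<Rightarrow> real) \<Rightarrow> 'a \<Rightarrow> 'a set" where
  "subdifferential \<phi> x = {g. \<forall>y. \<phi> y \<ge> \<phi> x + inner g (y - x)}"

definition Lmax ::
  "('a::euclidean_space \<Rightarrow> real) \<Rightarrow> 'b::topological_space measure \<Rightarrow> ('a \<Rightarrow> 'b \<Rightarrow> real)
     \<Rightarrow> 'a \<Rightarrow> 'b \<Rightarrow> real" where
  "Lmax nrm P F x z =
     Sup {conj_norm nrm (g - h) | g h.
            g \<in> subdifferential (\<lambda>y. F y z) x \<and> h \<in> subdifferential (expected P F) x}"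

definition Opt :: "'b::topological_space measure \<Rightarrow> ('a \<Rightarrow> 'b \<Rightarrow> real) \<Rightarrow> 'a set \<Rightarrow> real" where
  "Opt P F X = (INF x\<in>X. expected P F x)"

definition OptN :: "('a \<Rightarrow> 'b \<Rightarrow> real) \<Rightarrow> 'a set \<Rightarrow> nat \<Rightarrow> (nat \<Rightarrow> 'b) \<Rightarrow> real" where
  "OptN F X N z = (INF x\<in>X. (1 / real N) * (\<Sum>t=1..N. F x (z t)))"

definition tau_star :: real where
  "tau_star = Inf {\<tau>. 0 < \<tau> \<and> (\<forall>t::real. exp t \<le> t + exp (\<tau> * t\<^sup>2))}"

definition a_bound :: "real \<Rightarrow> real \<Rightarrow> nat \<Rightarrow> real" where
  "a_bound M1 \<mu> N = \<mu> * M1 / sqrt (real N)"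

definition b_bound ::
  "real \<Rightarrow> real \<Rightarrow> real \<Rightarrow> real \<Rightarrow> real \<Rightarrow> real \<Rightarrow> real \<Rightarrow> nat \<Rightarrow> real" where
  "b_bound M1 M2 \<Omega> R \<mu> s l N =
     (\<mu> * M1 + (\<Omega> * (1 + s\<^sup>2) + 2 * l) * M2 * R) / sqrt (real N)"

end

theory Submission
  imports Defs "HOL-Real_Asymp.Real_Asymp"
begin

text \<open>
  Let \<open>x\<close> minimise \<open>f\<close> over \<open>X\<close>. The upper bound compares the two optimal values at the point \<open>x\<close>
  only: the empirical optimum is at most the empirical mean of \<open>F(x,\<xi>\<^sub>t)\<close>, whose deviation from
  \<open>f(x)\<close> is a sum of centred variables with a square-exponential moment. Such sums have a
  sub-Gaussian tail (\<open>sub_gaussian_tail\<close>).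

  For the lower bound, linearise \<open>F(\<cdot>,\<xi>\<^sub>t)\<close> at \<open>x\<close>. If \<open>g\<^sub>t\<close> is a subgradient there and
  \<open>\<delta>\<^sub>t = g\<^sub>t - \<nabla>f(x)\<close>, then, because \<open>\<langle>\<nabla>f(x), y - x\<rangle> \<ge> 0\<close> on \<open>X\<close> and \<open>X\<close> lies in a ball of centre
  \<open>c\<close> and radius \<open>R\<close>, the empirical optimum is at least the empirical mean of \<open>F(x,\<xi>\<^sub>t)\<close> minus
  \<open>(R \<parallel>\<Sum>\<delta>\<^sub>t\<parallel>\<^sub>* + \<langle>\<Sum>\<delta>\<^sub>t, x - c\<rangle>) / N\<close> (\<open>OptN_lower_bound\<close>). The mean is handled as before. The conjugate
  norm of \<open>\<Sum>\<delta>\<^sub>t\<close> is linearised by playing dual averaging on the unit ball against the sequence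
  \<open>\<delta>\<^sub>1, \<delta>\<^sub>2, \<dots>\<close>: with the iterates \<open>u\<^sub>t\<close>, which depend on the earlier \<open>\<delta>\<^sub>j\<close> only, the regret bound reads
  \<open>\<parallel>\<Sum>\<delta>\<^sub>t\<parallel>\<^sub>* \<le> \<Omega>\<^sup>2/(2\<gamma>) + \<Sum>\<langle>\<delta>\<^sub>t, u\<^sub>t\<rangle> + (\<gamma>/2) \<Sum>\<parallel>\<delta>\<^sub>t\<parallel>\<^sub>*\<^sup>2\<close> (\<open>dual_averaging_regret\<close>). Together with
  \<open>x - c = R v\<close>, \<open>\<parallel>v\<parallel> \<le> 1\<close>, the random linear terms form the martingale sum
  \<open>R \<Sum>\<langle>\<delta>\<^sub>t, u\<^sub>t + v\<rangle>\<close> with increments at most \<open>2 R \<parallel>\<delta>\<^sub>t\<parallel>\<^sub>*\<close>; this is the term \<open>2 l M\<^sub>2 R\<close> of the bound, again by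
  \<open>sub_gaussian_tail\<close>. The sum of squares exceeds \<open>N s\<^sup>2 M\<^sub>2\<^sup>2\<close> with probability at most
  \<open>exp (- N (s\<^sup>2 - 1))\<close> by the exponential Markov inequality, and \<open>\<gamma> = \<Omega> / (M\<^sub>2 \<surd>N)\<close> balances
  the two remaining terms.

  The martingale property needs \<open>E g\<^sub>t = \<nabla>f(x)\<close> for a measurable choice of subgradients. It
  is obtained from directional derivatives instead of a selection theorem: those of \<open>F(\<cdot>,\<xi>)\<close> at
  \<open>x\<close> are measurable and have the directional derivative of \<open>f\<close> as expectation, and since the latter is linear while the former
  are sublinear, \<open>F(\<cdot>,\<xi>)\<close> almost surely has a linear directional derivative at \<open>x\<close>
  (\<open>unbiased_stochastic_gradient\<close>).
\<close>

section \<open>Exponential moments of centred variables\<close>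

text \<open>The exponent 1 is admissible in the infimum that defines \<open>tau_star\<close>, which is therefore taken
  over a nonempty set.\<close>

lemma exp_le_add_exp_square: "exp t \<le> t + exp (t\<^sup>2)" for t :: real
proof -
  consider "t < - 1" | "- 1 \<le> t" "t < 0" | "0 \<le> t" "t \<le> 1" | "1 < t" by linarith
  then show ?thesis
  proof cases
    case 1
    have "0 \<le> t * (t + 1)" using 1 by (intro mult_nonpos_nonpos) auto
    then have "1 \<le> t + (1 + t\<^sup>2)" by (simp add: power2_eq_square algebra_simps)
    moreover have "exp t \<le> 1" using 1 by simp
    ultimately show ?thesis using exp_ge_add_one_self[of "t\<^sup>2"] by linarith
  next
    case 2
    have "exp t \<le> 1 + t + t\<^sup>2"
    proof -
      have "exp t = 1 / exp (- t)" by (simp add: exp_minus field_simps)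
      also have "\<dots> \<le> 1 / (1 - t)"
        using 2 exp_ge_add_one_self[of "- t"] by (intro divide_left_mono mult_pos_pos) auto
      also have "\<dots> \<le> 1 + t + t\<^sup>2"
      proof -
        have "(1 + t + t\<^sup>2) * (1 - t) = 1 - t ^ 3" by (simp add: power2_eq_square power3_eq_cube algebra_simps)
        moreover have "t ^ 3 \<le> 0" using 2 by (simp add: power3_eq_cube mult_nonneg_nonpos mult_nonpos_nonpos)
        ultimately show ?thesis using 2 by (simp add: pos_divide_le_eq)
      qed
      finally show ?thesis .
    qed
    then show ?thesis using exp_ge_add_one_self[of "t\<^sup>2"] by linarith
  next
    case 3
    then show ?thesis using exp_bound[of t] exp_ge_add_one_self[of "t\<^sup>2"] by linarith
  next
    case 4
    then have "t \<le> t\<^sup>2" by (simp add: power2_eq_square)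
    then show ?thesis using 4 by (simp add: add_increasing)
  qed
qed

text \<open>For each fixed \<open>t\<close> the inequality is a closed condition on the exponent, so it survives in the
  infimum.\<close>

lemma tau_star_ineq: "exp t \<le> t + exp (tau_star * t\<^sup>2)"
proof -
  let ?T = "{\<tau>. 0 < \<tau> \<and> (\<forall>t::real. exp t \<le> t + exp (\<tau> * t\<^sup>2))}"
  have ne: "?T \<noteq> {}" using exp_le_add_exp_square by (auto intro: exI[of _ 1])
  have "Inf ?T \<in> closure ?T"
    by (rule closure_contains_Inf[OF ne]) (auto intro!: bdd_belowI[of _ 0])
  moreover have "closed {\<tau>. exp t \<le> t + exp (\<tau> * t\<^sup>2)}"
    by (intro closed_Collect_le continuous_intros)
  then have "closure ?T \<subseteq> {\<tau>. exp t \<le> t + exp (\<tau> * t\<^sup>2)}"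
    by (intro closure_minimal) auto
  ultimately show ?thesis unfolding tau_star_def by blast
qed

text \<open>Comparison of the second-order Taylor coefficients at 0. This is the only lower estimate of
  \<open>tau_star\<close> that the argument uses; it enters in the large-deviation case of
  \<open>sub_gaussian_tail\<close>.\<close>

lemma tau_star_ge_half: "1 / 2 \<le> tau_star"
proof -
  have "((\<lambda>t::real. (exp t - t - 1) / t\<^sup>2) \<longlongrightarrow> 1 / 2) (at_right 0)" by real_asymp
  moreover have "((\<lambda>t::real. (exp (tau_star * t\<^sup>2) - 1) / t\<^sup>2) \<longlongrightarrow> tau_star) (at_right 0)"
    by real_asymp
  moreover have "eventually (\<lambda>t::real. (exp t - t - 1) / t\<^sup>2 \<le> (exp (tau_star * t\<^sup>2) - 1) / t\<^sup>2) (at_right 0)"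
    by (intro always_eventually allI divide_right_mono) (use tau_star_ineq in \<open>auto simp: algebra_simps\<close>)
  ultimately show ?thesis by (intro tendsto_le[OF trivial_limit_at_right_real])
qed

text \<open>In \<open>exp a \<le> a + exp (tau_star * a\<^sup>2)\<close> the linear term has mean 0. The other one is dealt with by
  interpolation: with \<open>p = tau_star * t\<^sup>2 \<le> 1\<close>, convexity of \<open>exp\<close> on the segment from 0 to
  \<open>(Y/\<sigma>)\<^sup>2 - 1\<close> gives \<open>exp (p ((Y/\<sigma>)\<^sup>2 - 1)) \<le> p exp ((Y/\<sigma>)\<^sup>2 - 1) + (1 - p)\<close>, which has mean at most 1.\<close>

lemma mgf_le_of_exp_square:
  fixes Y :: "'b \<Rightarrow> real"
  assumes "prob_space P" and Y: "integrable P Y" "(LINT y|P. Y y) = 0" and "\<sigma> > 0"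
    and sq: "(\<integral>\<^sup>+y. ennreal (exp ((Y y)\<^sup>2 / \<sigma>\<^sup>2)) \<partial>P) \<le> ennreal (exp 1)"
    and small: "tau_star * t\<^sup>2 \<le> 1"
  shows "(\<integral>\<^sup>+y. ennreal (exp (t * Y y / \<sigma>)) \<partial>P) \<le> ennreal (exp (tau_star * t\<^sup>2))"
proof -
  interpret prob_space P by fact
  define p where "p = tau_star * t\<^sup>2"
  have p: "0 \<le> p" "p \<le> 1" using tau_star_ge_half small by (auto simp: p_def)
  have [measurable]: "Y \<in> borel_measurable P" using Y by auto
  define E where "E y = exp ((Y y)\<^sup>2 / \<sigma>\<^sup>2 - 1)" for y
  have E_pos: "0 < E y" for y by (simp add: E_def)
  have E_eq: "E y = exp ((Y y)\<^sup>2 / \<sigma>\<^sup>2) * exp (- 1)" for y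
    by (simp add: E_def exp_diff exp_minus field_simps)
  have "(\<integral>\<^sup>+y. ennreal (E y) \<partial>P) = (\<integral>\<^sup>+y. ennreal (exp ((Y y)\<^sup>2 / \<sigma>\<^sup>2)) \<partial>P) * ennreal (exp (- 1))"
    by (simp add: E_eq ennreal_mult nn_integral_multc)
  also have "\<dots> \<le> ennreal (exp 1) * ennreal (exp (- 1))" by (intro mult_right_mono sq) auto
  also have "\<dots> = 1" by (simp add: ennreal_mult[symmetric] exp_minus)
  finally have nnE: "(\<integral>\<^sup>+y. ennreal (E y) \<partial>P) \<le> 1" .
  have intE: "integrable P E"
    unfolding E_def[abs_def] by (rule integrableI_nonneg)
      (use nnE in \<open>auto simp: E_def intro: le_less_trans\<close>)
  have leE: "(LINT y|P. E y) \<le> 1"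
    using nnE nn_integral_eq_integral[OF intE] E_pos by (simp add: less_imp_le)
  have pw: "exp (t * Y y / \<sigma>) \<le> t * Y y / \<sigma> + exp p * (p * E y + (1 - p))" for y
  proof -
    have "exp ((1 - p) *\<^sub>R 0 + p *\<^sub>R ((Y y)\<^sup>2 / \<sigma>\<^sup>2 - 1)) \<le> (1 - p) * exp 0 + p * E y"
      unfolding E_def using p by (intro convex_onD[OF exp_convex]) auto
    then have "exp p * exp (p * ((Y y)\<^sup>2 / \<sigma>\<^sup>2 - 1)) \<le> exp p * (p * E y + (1 - p))"
      by (intro mult_left_mono) auto
    moreover have "exp p * exp (p * ((Y y)\<^sup>2 / \<sigma>\<^sup>2 - 1)) = exp (tau_star * (t * Y y / \<sigma>)\<^sup>2)"
      by (simp add: exp_add[symmetric] p_def algebra_simps power_mult_distrib power_divide)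
    ultimately show ?thesis using tau_star_ineq[of "t * Y y / \<sigma>"] by linarith
  qed
  have "(\<integral>\<^sup>+y. ennreal (exp (t * Y y / \<sigma>)) \<partial>P)
      \<le> (\<integral>\<^sup>+y. ennreal (t * Y y / \<sigma> + exp p * (p * E y + (1 - p))) \<partial>P)"
    by (intro nn_integral_mono ennreal_leI pw)
  also have "\<dots> = ennreal (LINT y|P. t * Y y / \<sigma> + exp p * (p * E y + (1 - p)))"
    using pw by (intro nn_integral_eq_integral) (auto simp: Y intE intro: order_trans[OF exp_ge_zero])
  also have "(LINT y|P. t * Y y / \<sigma> + exp p * (p * E y + (1 - p))) = exp p * (p * (LINT y|P. E y) + (1 - p))"
    using Y intE by (simp add: prob_space)
  also have "ennreal \<dots> \<le> ennreal (exp p)"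
  proof (rule ennreal_leI)
    have "p * (LINT y|P. E y) \<le> p" using mult_left_mono[OF leE p(1)] by simp
    then show "exp p * (p * (LINT y|P. E y) + (1 - p)) \<le> exp p" by simp
  qed
  finally show ?thesis by (simp add: p_def)
qed

section \<open>Tails of predictable sums over i.i.d. samples\<close>

text \<open>Adaptedness to the filtration generated by the samples, expressed directly on sample sequences
  \<open>z\<close>; the argument \<open>y\<close> is the fresh sample at time \<open>i\<close>, kept apart so that it can be integrated out.\<close>

definition predictable :: "(nat \<Rightarrow> (nat \<Rightarrow> 'b) \<Rightarrow> 'b \<Rightarrow> real) \<Rightarrow> bool" where
  "predictable h \<longleftrightarrow> (\<forall>i z z' y. (\<forall>j\<in>{1..<i}. z j = z' j) \<longrightarrow> h i z y = h i z' y)"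

lemma predictableD:
  "predictable h \<Longrightarrow> (\<And>j. j \<in> {1..<i} \<Longrightarrow> z j = z' j) \<Longrightarrow> h i z y = h i z' y"
  unfolding predictable_def by blast

lemma predictable_comp: "predictable h \<Longrightarrow> predictable (\<lambda>i z y. f (h i z y))"
  unfolding predictable_def by metis

text \<open>The product form of the supermartingale bound: integrating out the last sample costs a factor
  \<open>exp c\<close>, whatever the earlier samples are.\<close>

lemma nn_integral_exp_adapted_sum_le:
  fixes h :: "nat \<Rightarrow> (nat \<Rightarrow> 'b) \<Rightarrow> 'b \<Rightarrow> real"
  assumes "prob_space P"
    and meas: "\<And>n. (\<lambda>z. \<Sum>i=1..n. h i z (z i)) \<in> borel_measurable (PiM {1..n} (\<lambda>_. P))"
    and adapted: "predictable h"
    and step: "\<And>i z. (\<integral>\<^sup>+y. ennreal (exp (h i z y)) \<partial>P) \<le> ennreal (exp c)"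
  shows "(\<integral>\<^sup>+z. ennreal (exp (\<Sum>i=1..n. h i z (z i))) \<partial>PiM {1..n} (\<lambda>_. P)) \<le> ennreal (exp (real n * c))"
proof (induction n)
  interpret P: prob_space P by fact
  interpret product_sigma_finite "\<lambda>_::nat. P" by standard
  case 0
  show ?case by (simp add: PiM_empty nn_integral_count_space_finite)
next
  interpret P: prob_space P by fact
  interpret product_sigma_finite "\<lambda>_::nat. P" by standard
  case (Suc n)
  have ins: "{1..Suc n} = insert (Suc n) {1..n}" by auto
  let ?S = "\<lambda>n z. \<Sum>i=1..n. h i z (z i)"
  have split: "?S (Suc n) (x(Suc n := y)) = ?S n x + h (Suc n) x y" for x y
  proof -
    have "?S n (x(Suc n := y)) = ?S n x"
      by (intro sum.cong refl) (auto intro!: predictableD[OF adapted])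
    moreover have "h (Suc n) (x(Suc n := y)) y = h (Suc n) x y" by (intro predictableD[OF adapted]) auto
    ultimately show ?thesis by simp
  qed
  have "(\<integral>\<^sup>+z. ennreal (exp (?S (Suc n) z)) \<partial>PiM {1..Suc n} (\<lambda>_. P))
      = (\<integral>\<^sup>+x. \<integral>\<^sup>+y. ennreal (exp (?S (Suc n) (x(Suc n := y)))) \<partial>P \<partial>PiM {1..n} (\<lambda>_. P))"
    using meas[of "Suc n"] unfolding ins by (intro product_nn_integral_insert) auto
  also have "\<dots> = (\<integral>\<^sup>+x. \<integral>\<^sup>+y. ennreal (exp (?S n x)) * ennreal (exp (h (Suc n) x y)) \<partial>P \<partial>PiM {1..n} (\<lambda>_. P))"
    unfolding split by (simp add: exp_add ennreal_mult)
  also have "\<dots> \<le> (\<integral>\<^sup>+x. ennreal (exp (?S n x)) * ennreal (exp c) \<partial>PiM {1..n} (\<lambda>_. P))"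
  proof (rule nn_integral_mono)
    fix x assume x: "x \<in> space (PiM {1..n} (\<lambda>_. P))"
    have [measurable]: "(\<lambda>y. h (Suc n) x y) \<in> borel_measurable P"
    proof -
      have "(\<lambda>y. x(Suc n := y)) \<in> measurable P (PiM {1..Suc n} (\<lambda>_. P))"
        unfolding ins by (rule measurable_component_update[OF x]) auto
      from measurable_compose[OF this meas[of "Suc n"]]
      have "(\<lambda>y. ?S n x + h (Suc n) x y) \<in> borel_measurable P" unfolding split .
      then have "(\<lambda>y. (?S n x + h (Suc n) x y) - ?S n x) \<in> borel_measurable P"
        by (rule borel_measurable_diff) auto
      then show ?thesis by simp
    qed
    have "(\<integral>\<^sup>+y. ennreal (exp (?S n x)) * ennreal (exp (h (Suc n) x y)) \<partial>P)
        = ennreal (exp (?S n x)) * (\<integral>\<^sup>+y. ennreal (exp (h (Suc n) x y)) \<partial>P)"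
      by (intro nn_integral_cmult) measurable
    also have "\<dots> \<le> ennreal (exp (?S n x)) * ennreal (exp c)" by (intro mult_left_mono step) auto
    finally show "(\<integral>\<^sup>+y. ennreal (exp (?S n x)) * ennreal (exp (h (Suc n) x y)) \<partial>P)
        \<le> ennreal (exp (?S n x)) * ennreal (exp c)" .
  qed
  also have "\<dots> = (\<integral>\<^sup>+x. ennreal (exp (?S n x)) \<partial>PiM {1..n} (\<lambda>_. P)) * ennreal (exp c)"
    using meas[of n] by (intro nn_integral_multc) auto
  also have "\<dots> \<le> ennreal (exp (real n * c)) * ennreal (exp c)" by (intro mult_right_mono Suc.IH) auto
  finally show ?case by (simp add: ennreal_mult[symmetric] exp_add[symmetric] algebra_simps)
qed

lemma iid_nn_integral_eq:
  fixes \<xi> :: "nat \<Rightarrow> 'w \<Rightarrow> 'b::topological_space"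
  assumes "prob_space M" "prob_space.indep_vars M (\<lambda>_. borel) \<xi> {1..}"
    and distr: "\<forall>t\<ge>1. distr M borel (\<xi> t) = P" and P: "sets P = sets borel"
    and N: "1 \<le> N"
  shows "G \<in> borel_measurable (PiM {1..N} (\<lambda>_. P)) \<Longrightarrow>
      (\<integral>\<^sup>+w. G (\<lambda>t\<in>{1..N}. \<xi> t w) \<partial>M) = (\<integral>\<^sup>+z. G z \<partial>PiM {1..N} (\<lambda>_. P))"
    and "(\<lambda>w. \<lambda>t\<in>{1..N}. \<xi> t w) \<in> measurable M (PiM {1..N} (\<lambda>_. P))"
proof -
  interpret prob_space M by fact
  have iv: "indep_vars (\<lambda>_. borel) \<xi> {1..N}"
    by (rule indep_vars_subset[OF assms(2)]) auto
  then have rv: "\<xi> t \<in> borel_measurable M" if "t \<in> {1..N}" for t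
    using that by (auto simp: indep_vars_def)
  have sets_eq: "sets (PiM {1..N} (\<lambda>_. borel)) = sets (PiM {1..N} (\<lambda>_. P))"
    using P by (intro sets_PiM_cong) auto
  have mm: "(\<lambda>w. \<lambda>t\<in>{1..N}. \<xi> t w) \<in> measurable M (PiM {1..N} (\<lambda>_. borel))"
    using rv by (intro measurable_restrict) auto
  show m: "(\<lambda>w. \<lambda>t\<in>{1..N}. \<xi> t w) \<in> measurable M (PiM {1..N} (\<lambda>_. P))"
    using mm measurable_cong_sets[OF refl sets_eq] by blast
  have eq: "distr M (PiM {1..N} (\<lambda>_. borel)) (\<lambda>w. \<lambda>t\<in>{1..N}. \<xi> t w) = PiM {1..N} (\<lambda>_. P)"
  proof -
    have "distr M (PiM {1..N} (\<lambda>_. borel)) (\<lambda>w. \<lambda>t\<in>{1..N}. \<xi> t w)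
        = PiM {1..N} (\<lambda>t. distr M borel (\<xi> t))"
      using iv rv N by (subst indep_vars_iff_distr_eq_PiM'[symmetric]) auto
    also have "\<dots> = PiM {1..N} (\<lambda>_. P)" using distr by (intro PiM_cong) auto
    finally show ?thesis .
  qed
  assume "G \<in> borel_measurable (PiM {1..N} (\<lambda>_. P))"
  then have "G \<in> borel_measurable (distr M (PiM {1..N} (\<lambda>_. borel)) (\<lambda>w. \<lambda>t\<in>{1..N}. \<xi> t w))"
    unfolding eq .
  from nn_integral_distr[OF mm this]
  show "(\<integral>\<^sup>+w. G (\<lambda>t\<in>{1..N}. \<xi> t w) \<partial>M) = (\<integral>\<^sup>+z. G z \<partial>PiM {1..N} (\<lambda>_. P))"
    unfolding eq by (rule sym)
qed

lemma adapted_sum_restrict: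
  fixes h :: "nat \<Rightarrow> (nat \<Rightarrow> 'b) \<Rightarrow> 'b \<Rightarrow> real"
  assumes "predictable h"
  shows "(\<Sum>i=1..N. h i (\<lambda>t\<in>{1..N}. z t) ((\<lambda>t\<in>{1..N}. z t) i)) = (\<Sum>i=1..N. h i z (z i))"
  by (intro sum.cong refl) (auto intro!: predictableD[OF assms])

text \<open>Exponential Markov inequality for a predictable sum along the i.i.d. sample, together with the
  measurability of the sum.\<close>

lemma adapted_sum_tail:
  fixes h :: "nat \<Rightarrow> (nat \<Rightarrow> 'b::topological_space) \<Rightarrow> 'b \<Rightarrow> real" and \<xi> :: "nat \<Rightarrow> 'w \<Rightarrow> 'b"
  assumes "prob_space P" and sets_P: "sets P = sets borel"
    and "prob_space M" and indep: "prob_space.indep_vars M (\<lambda>_. borel) \<xi> {1..}"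
    and distr: "\<forall>t\<ge>1. distr M borel (\<xi> t) = P"
    and meas: "\<And>n. (\<lambda>z. \<Sum>i=1..n. h i z (z i)) \<in> borel_measurable (PiM {1..n} (\<lambda>_. P))"
    and adapted: "predictable h"
    and N: "1 \<le> N"
  shows "(\<lambda>w. \<Sum>i=1..N. h i (\<lambda>t. \<xi> t w) (\<xi> i w)) \<in> borel_measurable M"
    and "(\<And>i z. (\<integral>\<^sup>+y. ennreal (exp (h i z y)) \<partial>P) \<le> ennreal (exp c)) \<Longrightarrow>
      measure M {w \<in> space M. a < (\<Sum>i=1..N. h i (\<lambda>t. \<xi> t w) (\<xi> i w))} \<le> exp (real N * c - a)"
proof -
  interpret prob_space M by fact
  let ?S = "\<lambda>w. \<Sum>i=1..N. h i (\<lambda>t. \<xi> t w) (\<xi> i w)"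
  note restr = adapted_sum_restrict[where h = h, OF adapted]
  note iid = iid_nn_integral_eq[OF assms(3) indep distr sets_P N]
  show [measurable]: "?S \<in> borel_measurable M"
    using measurable_compose[OF iid(2) meas[of N]] unfolding restr .
  assume step: "\<And>i z. (\<integral>\<^sup>+y. ennreal (exp (h i z y)) \<partial>P) \<le> ennreal (exp c)"
  have "(\<integral>\<^sup>+w. ennreal (exp (?S w)) \<partial>M) \<le> ennreal (exp (real N * c))"
    using iid(1)[of "\<lambda>z. ennreal (exp (\<Sum>i=1..N. h i z (z i)))"] meas[of N]
      nn_integral_exp_adapted_sum_le[OF assms(1) meas adapted step, of N]
    unfolding restr by simp
  then have "ennreal (exp (- a)) * (\<integral>\<^sup>+w. ennreal (exp (?S w)) \<partial>M) \<le> ennreal (exp (- a)) * ennreal (exp (real N * c))"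
    by (intro mult_left_mono) auto
  also have "\<dots> = ennreal (exp (real N * c - a))" by (simp add: ennreal_mult[symmetric] exp_add[symmetric])
  finally have int: "ennreal (exp (- a)) * (\<integral>\<^sup>+w. ennreal (exp (?S w)) \<partial>M) \<le> ennreal (exp (real N * c - a))" .
  have "emeasure M {w \<in> space M. a < ?S w} \<le> emeasure M {w \<in> space M. 1 \<le> ennreal (exp (- a)) * ennreal (exp (?S w))}"
  proof (rule emeasure_mono)
    show "{w \<in> space M. 1 \<le> ennreal (exp (- a)) * ennreal (exp (?S w))} \<in> sets M" by measurable
  qed (auto simp: ennreal_mult[symmetric] exp_add[symmetric])
  also have "\<dots> \<le> ennreal (exp (- a)) * (\<integral>\<^sup>+w. ennreal (exp (?S w)) * indicator (space M) w \<partial>M)"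
    by (intro nn_integral_Markov_inequality) measurable
  also have "(\<integral>\<^sup>+w. ennreal (exp (?S w)) * indicator (space M) w \<partial>M) = (\<integral>\<^sup>+w. ennreal (exp (?S w)) \<partial>M)"
    by (intro nn_integral_cong) auto
  also note int
  finally show "measure M {w \<in> space M. a < ?S w} \<le> exp (real N * c - a)"
    by (simp add: emeasure_eq_measure)
qed

text \<open>As long as \<open>\<mu>\<^sup>2 \<le> 4 tau_star N\<close> the optimal Chernoff parameter \<open>t\<close> satisfies
  \<open>tau_star * t\<^sup>2 \<le> 1\<close>, and \<open>mgf_le_of_exp_square\<close> applies. Beyond this range that estimate of the
  moment generating function fails to apply, but Cauchy-Schwarz reduces the event to
  \<open>\<Sum> (Y\<^sub>i/\<sigma>)\<^sup>2 > \<mu>\<^sup>2\<close>, of probability at most \<open>exp (N - \<mu>\<^sup>2)\<close>; and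
  \<open>N \<le> \<mu>\<^sup>2 - \<mu>\<^sup>2 / (4 tau_star)\<close> there because \<open>tau_star \<ge> 1/2\<close>. The tail thus holds for every
  \<open>\<mu> \<ge> 0\<close>, as the parameter \<open>l\<close> of the confidence bound requires.\<close>

lemma sub_gaussian_tail:
  fixes Y :: "nat \<Rightarrow> (nat \<Rightarrow> 'b::topological_space) \<Rightarrow> 'b \<Rightarrow> real" and \<xi> :: "nat \<Rightarrow> 'w \<Rightarrow> 'b"
  assumes P: "prob_space P" "sets P = sets borel"
    and M: "prob_space M" "prob_space.indep_vars M (\<lambda>_. borel) \<xi> {1..}"
      "\<forall>t\<ge>1. distr M borel (\<xi> t) = P"
    and meas: "\<And>n i. i \<in> {1..n} \<Longrightarrow> (\<lambda>z. Y i z (z i)) \<in> borel_measurable (PiM {1..n} (\<lambda>_. P))"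
    and adapted: "predictable Y"
    and centred: "\<And>i z. integrable P (Y i z)" "\<And>i z. (LINT y|P. Y i z y) = 0"
    and light: "\<And>i z. (\<integral>\<^sup>+y. ennreal (exp ((Y i z y)\<^sup>2 / \<sigma>\<^sup>2)) \<partial>P) \<le> ennreal (exp 1)"
    and "\<sigma> > 0" "1 \<le> N" "0 \<le> \<mu>"
  shows "measure M {w \<in> space M. \<mu> * \<sigma> * sqrt (real N) < (\<Sum>i=1..N. Y i (\<lambda>t. \<xi> t w) (\<xi> i w))}
    \<le> exp (- (\<mu>\<^sup>2 / (4 * tau_star)))"
    (is "measure M ?A \<le> _")
proof -
  note tau = tau_star_ge_half
  note tail = adapted_sum_tail[OF P M]
  define n where "n = sqrt (real N)"
  have n: "n > 0" "n\<^sup>2 = real N" using \<open>1 \<le> N\<close> by (auto simp: n_def)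
  let ?Y = "\<lambda>i w. Y i (\<lambda>t. \<xi> t w) (\<xi> i w)"
  show ?thesis
  proof (cases "\<mu>\<^sup>2 \<le> 4 * tau_star * real N")
    case True
    \<comment> \<open>The minimiser of \<open>N * tau_star * t\<^sup>2 - t * \<mu> * n\<close>.\<close>
    define t where "t = \<mu> / (2 * tau_star * n)"
    have t2: "tau_star * t\<^sup>2 = \<mu>\<^sup>2 / (4 * tau_star * real N)"
      using tau n by (simp add: t_def power_divide power_mult_distrib power2_eq_square)
    have small: "tau_star * t\<^sup>2 \<le> 1" unfolding t2 using True tau \<open>1 \<le> N\<close> by (simp add: divide_le_eq_1)
    have meas1: "(\<lambda>z. \<Sum>i=1..n. t * Y i z (z i) / \<sigma>) \<in> borel_measurable (PiM {1..n} (\<lambda>_. P))" for n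
      by (intro borel_measurable_sum borel_measurable_divide borel_measurable_times meas) auto
    note adapted1 = predictable_comp[OF adapted, of "\<lambda>y. t * y / \<sigma>"]
    note step = mgf_le_of_exp_square[OF P(1) centred \<open>\<sigma> > 0\<close> light small]
    show ?thesis
    proof (cases "\<mu> = 0")
      case True
      then show ?thesis using prob_space.prob_le_1[OF M(1)] by simp
    next
      case False
      then have "t > 0" using \<open>0 \<le> \<mu>\<close> tau n by (simp add: t_def)
      have "?A = {w \<in> space M. t * \<mu> * n < (\<Sum>i=1..N. t * ?Y i w / \<sigma>)}"
      proof -
        have "(\<Sum>i=1..N. t * ?Y i w / \<sigma>) = (t / \<sigma>) * (\<Sum>i=1..N. ?Y i w)" for w
          by (simp add: sum_distrib_left)
        moreover have "(\<mu> * \<sigma> * n < S) \<longleftrightarrow> (t * \<mu> * n < (t / \<sigma>) * S)" for S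
          using \<open>t > 0\<close> \<open>\<sigma> > 0\<close> by (simp add: field_simps)
        ultimately show ?thesis by (simp add: n_def)
      qed
      also have "measure M \<dots> \<le> exp (real N * (tau_star * t\<^sup>2) - t * \<mu> * n)"
        by (rule tail(2)[OF meas1 adapted1 \<open>1 \<le> N\<close> step])
      also have "real N * (tau_star * t\<^sup>2) - t * \<mu> * n = - (\<mu>\<^sup>2 / (4 * tau_star))"
        unfolding t2 using tau n \<open>1 \<le> N\<close> by (simp add: t_def field_simps power2_eq_square)
      finally show ?thesis .
    qed
  next
    case False
    have "?A \<subseteq> {w \<in> space M. \<mu>\<^sup>2 < (\<Sum>i=1..N. (?Y i w)\<^sup>2 / \<sigma>\<^sup>2)}"
    proof safe
      fix w assume "\<mu> * \<sigma> * sqrt (real N) < (\<Sum>i=1..N. ?Y i w)"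
      then have "(\<mu> * \<sigma> * n)\<^sup>2 < (\<Sum>i=1..N. ?Y i w)\<^sup>2"
        using \<open>0 \<le> \<mu>\<close> \<open>\<sigma> > 0\<close> n by (intro power_strict_mono) (auto simp: n_def)
      also have "\<dots> \<le> (\<Sum>i=1..N. (1::real)\<^sup>2) * (\<Sum>i=1..N. (?Y i w)\<^sup>2)"
        using Cauchy_Schwarz_ineq_sum[of "\<lambda>_. 1" "\<lambda>i. ?Y i w" "{1..N}"] by simp
      finally show "\<mu>\<^sup>2 < (\<Sum>i=1..N. (?Y i w)\<^sup>2 / \<sigma>\<^sup>2)"
        using n \<open>\<sigma> > 0\<close> \<open>1 \<le> N\<close> by (simp add: power_mult_distrib sum_divide_distrib[symmetric] field_simps)
    qed
    moreover have meas': "(\<lambda>z. \<Sum>i=1..n. (Y i z (z i))\<^sup>2 / \<sigma>\<^sup>2) \<in> borel_measurable (PiM {1..n} (\<lambda>_. P))" for n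
      by (intro borel_measurable_sum borel_measurable_divide borel_measurable_power meas) auto
    note adapted' = predictable_comp[OF adapted, of "\<lambda>y. y\<^sup>2 / \<sigma>\<^sup>2"]
    note sq = tail[OF meas' adapted' \<open>1 \<le> N\<close>]
    have "{w \<in> space M. \<mu>\<^sup>2 < (\<Sum>i=1..N. (?Y i w)\<^sup>2 / \<sigma>\<^sup>2)} \<in> sets M"
      using sq(1) by measurable
    ultimately have "measure M ?A \<le> measure M {w \<in> space M. \<mu>\<^sup>2 < (\<Sum>i=1..N. (?Y i w)\<^sup>2 / \<sigma>\<^sup>2)}"
      using M(1) by (intro finite_measure.finite_measure_mono prob_space.finite_measure)
    also have "\<dots> \<le> exp (real N * 1 - \<mu>\<^sup>2)" by (rule sq(2)[OF light])
    also have "\<dots> \<le> exp (- (\<mu>\<^sup>2 / (4 * tau_star)))"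
    proof -
      have "real N * (4 * tau_star) \<le> \<mu>\<^sup>2" using False by (simp add: mult_ac)
      moreover have "\<mu>\<^sup>2 \<le> \<mu>\<^sup>2 * (4 * tau_star - 1)"
        using tau mult_left_mono[of 1 "4 * tau_star - 1" "\<mu>\<^sup>2"] by simp
      ultimately have "real N * (4 * tau_star) + \<mu>\<^sup>2 \<le> \<mu>\<^sup>2 * (4 * tau_star)" by (simp add: algebra_simps)
      then show ?thesis using tau by (simp add: field_simps)
    qed
    finally show ?thesis .
  qed
qed

section \<open>Norms on a Euclidean space and their conjugates\<close>

lemma is_normD:
  assumes "is_norm nrm"
  shows "0 \<le> nrm x" "nrm 0 = 0" "nrm x = 0 \<longleftrightarrow> x = 0" "nrm (c *\<^sub>R x) = \<bar>c\<bar> * nrm x"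
    "nrm (x + y) \<le> nrm x + nrm y" "nrm (- x) = nrm x" "nrm (x - y) \<le> nrm x + nrm y"
    "nrm (x - y) = nrm (y - x)"
proof -
  show 1: "0 \<le> nrm x" "nrm 0 = 0" "nrm x = 0 \<longleftrightarrow> x = 0" "nrm (c *\<^sub>R x) = \<bar>c\<bar> * nrm x"
    "nrm (x + y) \<le> nrm x + nrm y" for x y c
    using assms unfolding is_norm_def by blast+
  show 2: "nrm (- x) = nrm x" for x using 1(4)[of "-1" x] by simp
  show "nrm (x - y) \<le> nrm x + nrm y" using 1(5)[of x "- y"] 2[of y] by simp
  show "nrm (x - y) = nrm (y - x)" using 2[of "x - y"] by simp
qed

text \<open>Equivalence with the Euclidean norm; it carries compactness and continuity arguments over to
  the given norm.\<close>

lemma is_norm_bounds: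
  fixes nrm :: "'a::euclidean_space \<Rightarrow> real"
  assumes "is_norm nrm"
  obtains c C where "c > 0" "C > 0" "\<And>x. c * norm x \<le> nrm x" "\<And>x. nrm x \<le> C * norm x"
    "continuous_on UNIV nrm"
proof -
  note n = is_normD[OF assms]
  define C where "C = (\<Sum>b\<in>Basis. nrm (b::'a)) + 1"
  have C: "C > 0" unfolding C_def by (intro add_nonneg_pos sum_nonneg n) auto
  have up: "nrm x \<le> C * norm x" for x
  proof -
    have sub: "nrm (\<Sum>b\<in>B. f b) \<le> (\<Sum>b\<in>B. nrm (f b))" if "finite B" for B and f :: "'a \<Rightarrow> 'a"
      using that
    proof (induction B)
      case (insert b B)
      then show ?case using n(5)[of "f b" "\<Sum>b\<in>B. f b"] by simp
    qed (simp add: n)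
    have "nrm x = nrm (\<Sum>b\<in>Basis. (x \<bullet> b) *\<^sub>R b)" by (simp add: euclidean_representation)
    also have "\<dots> \<le> (\<Sum>b\<in>Basis. nrm ((x \<bullet> b) *\<^sub>R b))" by (rule sub) simp
    also have "\<dots> \<le> (\<Sum>b\<in>Basis. norm x * nrm b)"
      using Basis_le_norm by (intro sum_mono) (auto simp: n intro!: mult_right_mono)
    also have "\<dots> = norm x * (\<Sum>b\<in>Basis. nrm (b::'a))" by (simp add: sum_distrib_left)
    also have "\<dots> \<le> norm x * C" unfolding C_def by (intro mult_left_mono) auto
    finally show ?thesis by (simp add: mult_ac)
  qed
  have "dist (nrm x) (nrm y) \<le> C * dist x y" for x y
    using n(5)[of "x - y" y] n(5)[of "y - x" x] n(8)[of x y] up[of "x - y"]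
    by (simp add: dist_real_def dist_norm)
  then have cont: "continuous_on UNIV nrm"
    using C by (intro lipschitz_on_continuous_on[OF lipschitz_onI[of UNIV nrm C]]) auto
  have "\<exists>x\<in>sphere 0 1. \<forall>y\<in>sphere 0 1. nrm x \<le> nrm (y::'a)"
    by (intro continuous_attains_inf) (auto intro: continuous_on_subset[OF cont])
  then obtain x :: 'a where x: "norm x = 1" "\<And>y. norm y = 1 \<Longrightarrow> nrm x \<le> nrm y" by auto
  have pos: "nrm x > 0" using n(1)[of x] n(3)[of x] x(1) by (cases "x = 0") auto
  have "nrm x * norm y \<le> nrm y" for y
  proof (cases "y = 0")
    case False
    then have "nrm x \<le> nrm ((1 / norm y) *\<^sub>R y)" by (intro x(2)) simp
    with False show ?thesis by (simp add: n(4) field_simps)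
  qed (simp add: n)
  with that pos C up cont show ?thesis by blast
qed

lemma nball_unit: "nball nrm 0 1 = {x. nrm x \<le> 1}" by (simp add: nball_def)

lemma compact_nball_unit:
  fixes nrm :: "'a::euclidean_space \<Rightarrow> real"
  assumes "is_norm nrm"
  shows "compact (nball nrm 0 1)"
proof -
  obtain c C where c: "c > 0" "\<And>x. c * norm x \<le> nrm x" and cont: "continuous_on UNIV nrm"
    using is_norm_bounds[OF assms] by metis
  have "bounded (nball nrm 0 1)"
  proof (rule boundedI)
    fix x assume "x \<in> nball nrm 0 1"
    then have "c * norm x \<le> 1" using c(2)[of x] by (simp add: nball_unit)
    then show "norm x \<le> 1 / c" using c(1) by (simp add: field_simps)
  qed
  moreover have "closed (nball nrm 0 1)"
    unfolding nball_unit using cont by (intro closed_Collect_le continuous_intros)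
  ultimately show ?thesis by (simp add: compact_eq_bounded_closed)
qed

lemma conj_norm_facts:
  fixes nrm :: "'a::euclidean_space \<Rightarrow> real"
  assumes nrm: "is_norm nrm"
  shows inner_le_conj_norm: "inner x y \<le> nrm x * conj_norm nrm y"
    and conj_norm_le: "(\<And>x. nrm x \<le> 1 \<Longrightarrow> inner x y \<le> B) \<Longrightarrow> conj_norm nrm y \<le> B"
    and conj_norm_nonneg: "0 \<le> conj_norm nrm y"
proof -
  note n = is_normD[OF nrm]
  have ne: "nball nrm 0 1 \<noteq> {}" using n(2) by (auto simp: nball_unit intro!: exI[of _ 0])
  have "bounded ((\<lambda>x. inner x y) ` nball nrm 0 1)"
    by (intro compact_imp_bounded compact_continuous_image continuous_intros compact_nball_unit nrm)
  then have bdd: "bdd_above ((\<lambda>x. inner x y) ` nball nrm 0 1)" by (rule bounded_imp_bdd_above)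
  have up: "inner x y \<le> conj_norm nrm y" if "nrm x \<le> 1" for x
    unfolding conj_norm_def using that by (intro cSUP_upper bdd) (auto simp: nball_unit)
  show "(\<And>x. nrm x \<le> 1 \<Longrightarrow> inner x y \<le> B) \<Longrightarrow> conj_norm nrm y \<le> B"
    unfolding conj_norm_def using ne by (intro cSUP_least) (auto simp: nball_unit)
  show "0 \<le> conj_norm nrm y" using up[of 0] by (simp add: n)
  show "inner x y \<le> nrm x * conj_norm nrm y"
  proof (cases "x = 0")
    case False
    then have "nrm x > 0" using n(1)[of x] n(3)[of x] by linarith
    moreover have "inner ((1 / nrm x) *\<^sub>R x) y \<le> conj_norm nrm y"
      using \<open>nrm x > 0\<close> by (intro up) (simp add: n(4))
    ultimately show ?thesis by (simp add: field_simps)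
  qed (simp add: n)
qed

lemma conj_norm_le_norm:
  fixes nrm :: "'a::euclidean_space \<Rightarrow> real"
  assumes nrm: "is_norm nrm"
  obtains K where "0 < K" "\<And>y. conj_norm nrm y \<le> K * norm y"
proof -
  obtain c C where c: "c > 0" "\<And>x. c * norm x \<le> nrm x"
    using is_norm_bounds[OF assms] by metis
  have "conj_norm nrm y \<le> (1 / c) * norm y" for y
  proof (rule conj_norm_le[OF nrm])
    fix x assume x: "nrm x \<le> 1"
    have "inner x y \<le> norm x * norm y" by (rule norm_cauchy_schwarz)
    also have "norm x \<le> 1 / c" using c x order_trans[OF c(2)[of x] x] by (simp add: field_simps)
    then have "norm x * norm y \<le> 1 / c * norm y" by (intro mult_right_mono) auto
    finally show "inner x y \<le> 1 / c * norm y" .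
  qed
  with that c(1) show ?thesis by (meson zero_less_divide_1_iff)
qed

lemma continuous_on_conj_norm:
  fixes nrm :: "'a::euclidean_space \<Rightarrow> real"
  assumes nrm: "is_norm nrm"
  shows "continuous_on UNIV (conj_norm nrm)"
proof -
  obtain K where K: "0 < K" "\<And>y. conj_norm nrm y \<le> K * norm y" using conj_norm_le_norm[OF nrm] by blast
  have tri: "conj_norm nrm y \<le> conj_norm nrm y' + K * norm (y - y')" for y y'
  proof (rule conj_norm_le[OF nrm])
    fix x assume x: "nrm x \<le> 1"
    have le: "inner x y \<le> conj_norm nrm y" for y
      using inner_le_conj_norm[OF nrm, of x y] mult_right_mono[OF x conj_norm_nonneg[OF nrm, of y]] by simp
    have "inner x y = inner x y' + inner x (y - y')" by (simp add: inner_diff_right)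
    then show "inner x y \<le> conj_norm nrm y' + K * norm (y - y')"
      using le[of y'] le[of "y - y'"] K(2)[of "y - y'"] by linarith
  qed
  have "dist (conj_norm nrm y) (conj_norm nrm y') \<le> K * dist y y'" for y y'
    using tri[of y y'] tri[of y' y] by (simp add: dist_real_def dist_norm norm_minus_commute)
  then show ?thesis
    using K(1) by (intro lipschitz_on_continuous_on[OF lipschitz_onI[of UNIV _ K]]) auto
qed

text \<open>Centres of balls whose radii decrease to the infimum stay bounded, and a limit point of them is
  the centre of a ball of the minimal radius.\<close>

lemma min_radius_attained:
  fixes nrm :: "'a::euclidean_space \<Rightarrow> real"
  assumes nrm: "is_norm nrm" and X: "X \<noteq> {}" "compact X"
  obtains c where "0 \<le> min_radius nrm X" "\<And>x. x \<in> X \<Longrightarrow> nrm (x - c) \<le> min_radius nrm X"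
proof -
  note n = is_normD[OF nrm]
  obtain k K where k: "k > 0" "\<And>x. k * norm x \<le> nrm x" and K: "K > 0" "\<And>x. nrm x \<le> K * norm x"
    and cont: "continuous_on UNIV nrm"
    using is_norm_bounds[OF nrm] by metis
  let ?R = "{r. 0 \<le> r \<and> (\<exists>c. X \<subseteq> nball nrm c r)}"
  obtain B where B: "\<And>x. x \<in> X \<Longrightarrow> norm x \<le> B" "0 < B"
    using compact_imp_bounded[OF X(2)] by (meson bounded_pos)
  have "X \<subseteq> nball nrm 0 (K * B)"
    using B K(1) by (auto simp: nball_def intro!: order_trans[OF K(2)] mult_left_mono)
  then have "K * B \<in> ?R" using K(1) B(2) by auto
  then have ne: "?R \<noteq> {}" by blast
  have bdd: "bdd_below ?R" by (auto intro: bdd_belowI[of _ 0])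
  define R where "R = min_radius nrm X"
  have R: "R = Inf ?R" by (simp add: R_def min_radius_def)
  have R0: "0 \<le> R" unfolding R by (rule cInf_greatest[OF ne]) auto
  have "\<exists>c. X \<subseteq> nball nrm c (R + inverse (real (Suc m)))" for m
  proof -
    obtain r where "r \<in> ?R" "r < R + inverse (real (Suc m))"
      using cInf_lessD[OF ne, of "R + inverse (real (Suc m))"] unfolding R by auto
    then obtain c where "X \<subseteq> nball nrm c r" "r < R + inverse (real (Suc m))" by blast
    then show ?thesis by (intro exI[of _ c]) (auto simp: nball_def)
  qed
  then obtain cs where cs: "\<And>m. X \<subseteq> nball nrm (cs m) (R + inverse (real (Suc m)))" by metis
  obtain x0 where x0: "x0 \<in> X" using X by blast
  have "bounded (range cs)"
  proof (rule boundedI)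
    fix y assume "y \<in> range cs"
    then obtain m where y: "y = cs m" by auto
    have "nrm (x0 - y) \<le> R + inverse (real (Suc m))" using cs[of m] x0 by (auto simp: y nball_def)
    also have "\<dots> \<le> R + 1" by (simp add: inverse_le_1_iff)
    finally have "norm (x0 - y) \<le> (R + 1) / k" using k(1) order_trans[OF k(2)] by (simp add: field_simps)
    then show "norm y \<le> norm x0 + (R + 1) / k"
      using norm_triangle_ineq4[of x0 "x0 - y"] by simp
  qed
  then obtain c r where r: "strict_mono r" "(cs \<circ> r) \<longlonglongrightarrow> c"
    using bounded_imp_convergent_subsequence by metis
  show ?thesis
  proof (rule that)
    show "0 \<le> min_radius nrm X" using R0 by (simp add: R_def)
    fix x assume x: "x \<in> X"
    have "(\<lambda>m. nrm (x - cs (r m))) \<longlonglongrightarrow> nrm (x - c)"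
      using r(2) cont
      by (intro continuous_on_tendsto_compose[OF cont] tendsto_intros) (auto simp: o_def)
    moreover have "(\<lambda>m. R + inverse (real (Suc (r m)))) \<longlonglongrightarrow> R + 0"
      by (intro tendsto_intros filterlim_compose[OF LIMSEQ_inverse_real_of_nat filterlim_subseq[OF r(1)]])
    ultimately have "nrm (x - c) \<le> R + 0"
      using cs x by (intro LIMSEQ_le) (auto simp: nball_def)
    then show "nrm (x - c) \<le> min_radius nrm X" by (simp add: R_def)
  qed
qed

section \<open>Dual averaging on the unit ball\<close>

text \<open>Integrated form of the strong monotonicity of the gradient: along the segment from \<open>x\<close> to \<open>y\<close>
  the function \<open>\<psi>\<close> below, which subtracts from \<open>\<omega>\<close> its linear part and the quadratic \<open>t\<^sup>2 \<parallel>y - x\<parallel>\<^sup>2 / 2\<close>,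
  has a nonnegative derivative.\<close>

lemma distance_generating_strongly_convex:
  fixes nrm :: "'a::euclidean_space \<Rightarrow> real"
  assumes nrm: "is_norm nrm" and omega: "distance_generating nrm \<omega>"
  shows "\<exists>grad. (\<forall>x y. nrm x \<le> 1 \<longrightarrow> nrm y \<le> 1 \<longrightarrow>
        \<omega> x + inner (grad x) (y - x) + (nrm (y - x))\<^sup>2 / 2 \<le> \<omega> y)
      \<and> grad 0 = 0 \<and> \<omega> 0 = 0 \<and> continuous_on (nball nrm 0 1) \<omega>"
proof -
  note n = is_normD[OF nrm]
  let ?B = "nball nrm 0 1"
  obtain grad where
    der: "\<And>x. x \<in> ?B \<Longrightarrow> (\<omega> has_derivative (\<lambda>h. inner (grad x) h)) (at x within ?B)" and
    mono: "\<And>x y. x \<in> ?B \<Longrightarrow> y \<in> ?B \<Longrightarrow> inner (grad x - grad y) (x - y) \<ge> (nrm (x - y))\<^sup>2" and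
    zero: "\<omega> 0 = 0" "grad 0 = 0"
    using omega unfolding distance_generating_def by metis
  have strong: "\<omega> x + inner (grad x) (y - x) + (nrm (y - x))\<^sup>2 / 2 \<le> \<omega> y"
    if xy: "nrm x \<le> 1" "nrm y \<le> 1" for x y
  proof -
    define z where "z t = x + t *\<^sub>R (y - x)" for t
    have zB: "z t \<in> ?B" if "0 \<le> t" "t \<le> 1" for t
    proof -
      have "z t = (1 - t) *\<^sub>R x + t *\<^sub>R y" by (simp add: z_def algebra_simps)
      then have "nrm (z t) \<le> (1 - t) * nrm x + t * nrm y"
        using n(5)[of "(1 - t) *\<^sub>R x" "t *\<^sub>R y"] that by (simp add: n)
      also have "\<dots> \<le> (1 - t) * 1 + t * 1" using xy that by (intro add_mono mult_left_mono) auto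
      finally show ?thesis by (simp add: nball_unit)
    qed
    define \<psi> where "\<psi> t = \<omega> (z t) - t * inner (grad x) (y - x) - t\<^sup>2 * ((nrm (y - x))\<^sup>2 / 2)" for t
    define \<psi>' where "\<psi>' t = inner (grad (z t)) (y - x) - inner (grad x) (y - x) - t * (nrm (y - x))\<^sup>2" for t
    have d\<psi>: "(\<psi> has_derivative (\<lambda>h. \<psi>' t * h)) (at t within {0..1})" if t: "0 \<le> t" "t \<le> 1" for t
    proof -
      have dz: "(z has_derivative (\<lambda>h. h *\<^sub>R (y - x))) (at t within {0..1})"
        unfolding z_def by (auto intro!: derivative_eq_intros)
      have "(\<omega> \<circ> z has_derivative (\<lambda>h. inner (grad (z t)) h) \<circ> (\<lambda>h. h *\<^sub>R (y - x))) (at t within {0..1})"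
        by (rule diff_chain_within[OF dz has_derivative_subset[OF der]]) (use zB t in auto)
      then have "((\<lambda>t. \<omega> (z t)) has_derivative (\<lambda>h. h * inner (grad (z t)) (y - x))) (at t within {0..1})"
        by (simp add: o_def)
      then show ?thesis
        unfolding \<psi>_def[abs_def] \<psi>'_def by (auto intro!: derivative_eq_intros simp: algebra_simps power2_eq_square)
    qed
    have "\<psi>' t \<ge> 0" if t: "0 \<le> t" "t \<le> 1" for t
    proof (cases "t = 0")
      case False
      have "(nrm (z t - x))\<^sup>2 \<le> inner (grad (z t) - grad x) (z t - x)"
        using zB[OF t] xy by (intro mono) (auto simp: nball_unit)
      then have "t * (t * (nrm (y - x))\<^sup>2) \<le> t * (inner (grad (z t) - grad x) (y - x))"
        using t by (simp add: z_def n power_mult_distrib power2_eq_square mult_ac)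
      then show ?thesis using False t by (simp add: \<psi>'_def inner_diff_left)
    qed (simp add: \<psi>'_def z_def)
    moreover have "\<exists>t\<in>{0<..<1}. \<psi> 1 - \<psi> 0 = \<psi>' t * (1 - 0)"
      by (rule mvt_simple) (use d\<psi> in auto)
    ultimately have "\<psi> 0 \<le> \<psi> 1" by (auto simp: greaterThanLessThan_iff) (smt (verit))
    then show ?thesis by (simp add: \<psi>_def z_def)
  qed
  have "continuous_on ?B \<omega>" using der by (rule has_derivative_continuous_on)
  with strong zero show ?thesis by (intro exI[of _ grad]) auto
qed

text \<open>Positivity holds because strong convexity forces \<open>\<omega> e \<ge> 1/2\<close> at any vector \<open>e\<close> of norm 1, and
  such vectors exist in a space of positive dimension.\<close>

lemma Omega_facts:
  fixes nrm :: "'a::euclidean_space \<Rightarrow> real"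
  assumes nrm: "is_norm nrm" and omega: "distance_generating nrm \<omega>"
  shows omega_le_Omega: "nrm x \<le> 1 \<Longrightarrow> \<omega> x \<le> (Omega nrm \<omega>)\<^sup>2 / 2"
    and omega_nonneg: "nrm x \<le> 1 \<Longrightarrow> 0 \<le> \<omega> x"
    and Omega_pos: "0 < Omega nrm \<omega>"
proof -
  note n = is_normD[OF nrm]
  obtain grad where
    strong: "\<And>x y. nrm x \<le> 1 \<Longrightarrow> nrm y \<le> 1 \<Longrightarrow>
      \<omega> x + inner (grad x) (y - x) + (nrm (y - x))\<^sup>2 / 2 \<le> \<omega> y" and
    z: "grad 0 = 0" "\<omega> 0 = 0" and cont: "continuous_on (nball nrm 0 1) \<omega>"
    using distance_generating_strongly_convex[OF nrm omega] by blast
  have low: "(nrm y)\<^sup>2 / 2 \<le> \<omega> y" if "nrm y \<le> 1" for y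
    using strong[of 0 y] that z n(2) by simp
  show nonneg: "0 \<le> \<omega> x" if "nrm x \<le> 1" for x
    using low[OF that] zero_le_power2[of "nrm x"] by linarith
  have "bounded ((\<lambda>x. sqrt (2 * \<omega> x)) ` nball nrm 0 1)"
    by (intro compact_imp_bounded compact_continuous_image continuous_intros cont compact_nball_unit nrm)
  then have bdd: "bdd_above ((\<lambda>x. sqrt (2 * \<omega> x)) ` nball nrm 0 1)" by (rule bounded_imp_bdd_above)
  have up: "sqrt (2 * \<omega> x) \<le> Omega nrm \<omega>" if "nrm x \<le> 1" for x
    unfolding Omega_def using that by (intro cSUP_upper bdd) (auto simp: nball_unit)
  show "\<omega> x \<le> (Omega nrm \<omega>)\<^sup>2 / 2" if "nrm x \<le> 1"
    using power_mono[OF up[OF that], of 2] nonneg[OF that] by simp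
  obtain b :: 'a where "b \<in> Basis" using nonempty_Basis by blast
  then have "b \<noteq> 0" by (rule nonzero_Basis)
  then have "nrm b > 0" using n(1)[of b] n(3)[of b] by linarith
  define e where "e = (1 / nrm b) *\<^sub>R b"
  have e: "nrm e = 1" using \<open>nrm b > 0\<close> by (simp add: e_def n(4))
  have "1 \<le> sqrt (2 * \<omega> e)" using low[of e] e by simp
  also have "\<dots> \<le> Omega nrm \<omega>" using e by (intro up) simp
  finally show "0 < Omega nrm \<omega>" by simp
qed

text \<open>The gradient at \<open>S\<close> of the conjugate \<open>S \<mapsto> max (\<langle>S, y\<rangle> - \<omega> y)\<close> of \<open>\<omega>\<close> over the unit ball.\<close>

definition prox :: "('a::euclidean_space \<Rightarrow> real) \<Rightarrow> ('a \<Rightarrow> real) \<Rightarrow> 'a \<Rightarrow> 'a" where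
  "prox nrm \<omega> S = (SOME u. nrm u \<le> 1 \<and> (\<forall>y. nrm y \<le> 1 \<longrightarrow> inner S y - \<omega> y \<le> inner S u - \<omega> u))"

text \<open>A maximiser of a strongly concave function dominates every other point by the quadratic term.
  To see it, compare the maximiser \<open>u\<close> with the points \<open>z\<close> of the segment from \<open>u\<close> to \<open>y\<close> at parameter
  \<open>\<theta>\<close> and let \<open>\<theta>\<close> tend to 0.\<close>

lemma prox_facts:
  fixes nrm :: "'a::euclidean_space \<Rightarrow> real"
  assumes nrm: "is_norm nrm" and omega: "distance_generating nrm \<omega>"
  shows prox_in_ball: "nrm (prox nrm \<omega> S) \<le> 1"
    and prox_quadratic_growth: "nrm y \<le> 1 \<Longrightarrow>
      inner S y - \<omega> y + (nrm (y - prox nrm \<omega> S))\<^sup>2 / 2 \<le> inner S (prox nrm \<omega> S) - \<omega> (prox nrm \<omega> S)"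
proof -
  note n = is_normD[OF nrm]
  obtain grad where
    strong: "\<And>x y. nrm x \<le> 1 \<Longrightarrow> nrm y \<le> 1 \<Longrightarrow>
      \<omega> x + inner (grad x) (y - x) + (nrm (y - x))\<^sup>2 / 2 \<le> \<omega> y" and
    cont: "continuous_on (nball nrm 0 1) \<omega>"
    using distance_generating_strongly_convex[OF nrm omega] by blast
  define u where "u = prox nrm \<omega> S"
  have "\<exists>u\<in>nball nrm 0 1. \<forall>y\<in>nball nrm 0 1. inner S y - \<omega> y \<le> inner S u - \<omega> u"
    using n(2) by (intro continuous_attains_sup compact_nball_unit nrm continuous_intros cont)
      (auto simp: nball_unit intro!: exI[of _ 0])
  then have "\<exists>u. nrm u \<le> 1 \<and> (\<forall>y. nrm y \<le> 1 \<longrightarrow> inner S y - \<omega> y \<le> inner S u - \<omega> u)"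
    by (auto simp: nball_unit)
  from someI_ex[OF this] have u: "nrm u \<le> 1" "\<And>y. nrm y \<le> 1 \<Longrightarrow> inner S y - \<omega> y \<le> inner S u - \<omega> u"
    unfolding u_def prox_def by auto
  show "nrm (prox nrm \<omega> S) \<le> 1" using u(1) by (simp add: u_def)
  assume y: "nrm y \<le> 1"
  define K where "K = (nrm (y - u))\<^sup>2 / 2"
  have step: "inner S y - \<omega> y + (1 - \<theta>) * K \<le> inner S u - \<omega> u" if \<theta>: "0 < \<theta>" "\<theta> < 1" for \<theta>
  proof -
    define z where "z = (1 - \<theta>) *\<^sub>R u + \<theta> *\<^sub>R y"
    have "nrm z \<le> (1 - \<theta>) * nrm u + \<theta> * nrm y"
      using n(5)[of "(1 - \<theta>) *\<^sub>R u" "\<theta> *\<^sub>R y"] \<theta> by (simp add: n z_def)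
    also have "\<dots> \<le> (1 - \<theta>) * 1 + \<theta> * 1" using u y \<theta> by (intro add_mono mult_left_mono) auto
    finally have z: "nrm z \<le> 1" by simp
    have du: "u - z = - (\<theta> *\<^sub>R (y - u))" and dy: "y - z = (1 - \<theta>) *\<^sub>R (y - u)"
      by (simp_all add: z_def algebra_simps)
    have 1: "\<omega> z - \<theta> * inner (grad z) (y - u) + \<theta>\<^sup>2 * K \<le> \<omega> u"
      using strong[OF z u(1)] unfolding du by (simp add: n K_def power_mult_distrib)
    have 2: "\<omega> z + (1 - \<theta>) * inner (grad z) (y - u) + (1 - \<theta>)\<^sup>2 * K \<le> \<omega> y"
      using strong[OF z y] unfolding dy by (simp add: n K_def power_mult_distrib)
    have "(1 - \<theta>) * (\<omega> z - \<theta> * inner (grad z) (y - u) + \<theta>\<^sup>2 * K)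
        + \<theta> * (\<omega> z + (1 - \<theta>) * inner (grad z) (y - u) + (1 - \<theta>)\<^sup>2 * K) \<le> (1 - \<theta>) * \<omega> u + \<theta> * \<omega> y"
      using \<theta> by (intro add_mono mult_left_mono 1 2) auto
    then have "\<omega> z + \<theta> * (1 - \<theta>) * K \<le> (1 - \<theta>) * \<omega> u + \<theta> * \<omega> y"
      by (simp add: algebra_simps power2_eq_square)
    moreover have "inner S z - \<omega> z \<le> inner S u - \<omega> u" by (rule u(2)[OF z])
    ultimately have "\<theta> * (inner S y - \<omega> y + (1 - \<theta>) * K) \<le> \<theta> * (inner S u - \<omega> u)"
      by (simp add: z_def inner_add_right algebra_simps)
    then show ?thesis using \<theta> by simp
  qed
  have "((\<lambda>\<theta>. inner S y - \<omega> y + (1 - \<theta>) * K) \<longlongrightarrow> inner S y - \<omega> y + (1 - 0) * K) (at_right 0)"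
    by (intro tendsto_intros)
  moreover have "eventually (\<lambda>\<theta>::real. 0 < \<theta> \<and> \<theta> < 1) (at_right 0)"
    unfolding eventually_at_right_field by (intro exI[of _ 1]) auto
  then have "eventually (\<lambda>\<theta>. inner S y - \<omega> y + (1 - \<theta>) * K \<le> inner S u - \<omega> u) (at_right 0)"
    by eventually_elim (use step in auto)
  ultimately have "inner S y - \<omega> y + (1 - 0) * K \<le> inner S u - \<omega> u"
    by (intro tendsto_upperbound) auto
  then show "inner S y - \<omega> y + (nrm (y - prox nrm \<omega> S))\<^sup>2 / 2 \<le> inner S (prox nrm \<omega> S) - \<omega> (prox nrm \<omega> S)"
    by (simp add: K_def u_def)
qed

text \<open>Adding the growth estimates at \<open>S\<close> and \<open>S'\<close> shows that the map is Lipschitz. Continuity is what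
  makes the dual averaging iterates measurable functions of the sample.\<close>

lemma continuous_on_prox:
  fixes nrm :: "'a::euclidean_space \<Rightarrow> real"
  assumes nrm: "is_norm nrm" and omega: "distance_generating nrm \<omega>"
  shows "continuous_on UNIV (prox nrm \<omega>)"
proof -
  obtain c where c: "c > 0" "\<And>x. c * norm x \<le> nrm x" using is_norm_bounds[OF nrm] by metis
  have "dist (prox nrm \<omega> S) (prox nrm \<omega> S') \<le> (1 / c\<^sup>2) * dist S S'" for S S'
  proof -
    let ?u = "prox nrm \<omega> S" and ?u' = "prox nrm \<omega> S'"
    have "(nrm (?u - ?u'))\<^sup>2 \<le> inner (S - S') (?u - ?u')"
      using prox_quadratic_growth[OF nrm omega prox_in_ball[OF nrm omega, of S], of S']
        prox_quadratic_growth[OF nrm omega prox_in_ball[OF nrm omega, of S'], of S]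
        is_normD(8)[OF nrm, of ?u ?u']
      by (simp add: inner_diff_left inner_diff_right)
    also have "\<dots> \<le> norm (S - S') * norm (?u - ?u')" by (rule norm_cauchy_schwarz)
    finally have "(c * norm (?u - ?u'))\<^sup>2 \<le> norm (S - S') * norm (?u - ?u')"
      using power_mono[OF c(2)[of "?u - ?u'"], of 2] c(1) by simp
    then have "norm (?u - ?u') * (c\<^sup>2 * norm (?u - ?u')) \<le> norm (?u - ?u') * norm (S - S')"
      by (simp add: power_mult_distrib power2_eq_square mult_ac)
    then have "c\<^sup>2 * norm (?u - ?u') \<le> norm (S - S')"
      by (cases "norm (?u - ?u') = 0") (auto dest: mult_left_le_imp_le)
    then show ?thesis using c(1) by (simp add: dist_norm field_simps)
  qed
  then show ?thesis
    by (intro lipschitz_on_continuous_on[OF lipschitz_onI[of UNIV _ "1 / c\<^sup>2"]]) auto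
qed

text \<open>The potential \<open>V n\<close> is the conjugate of \<open>\<omega>\<close> over the unit ball at \<open>\<gamma> \<Sum>\<^sub>i\<^sub>\<le>\<^sub>n \<delta>\<^sub>i\<close>. It starts
  at most at 0, it increases in step \<open>i\<close> by at most \<open>\<gamma> \<langle>\<delta>\<^sub>i, u\<^sub>i\<rangle> + \<gamma>\<^sup>2 \<parallel>\<delta>\<^sub>i\<parallel>\<^sub>*\<^sup>2 / 2\<close> by the quadratic growth at
  the iterate \<open>u\<^sub>i\<close>, and it finally dominates \<open>\<gamma> \<parallel>\<Sum>\<delta>\<^sub>i\<parallel>\<^sub>* - \<Omega>\<^sup>2/2\<close>.\<close>

lemma dual_averaging_regret:
  fixes nrm :: "'a::euclidean_space \<Rightarrow> real" and \<delta> :: "nat \<Rightarrow> 'a"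
  assumes nrm: "is_norm nrm" and omega: "distance_generating nrm \<omega>" and \<gamma>: "0 < \<gamma>"
  shows "conj_norm nrm (\<Sum>i=1..N. \<delta> i) \<le> (Omega nrm \<omega>)\<^sup>2 / (2 * \<gamma>)
    + (\<Sum>i=1..N. inner (\<delta> i) (prox nrm \<omega> (\<gamma> *\<^sub>R (\<Sum>j\<in>{1..<i}. \<delta> j))))
    + \<gamma> / 2 * (\<Sum>i=1..N. (conj_norm nrm (\<delta> i))\<^sup>2)"
proof -
  define u where "u n = prox nrm \<omega> (\<gamma> *\<^sub>R (\<Sum>j\<in>{1..<Suc n}. \<delta> j))" for n
  define V where "V n = inner (\<gamma> *\<^sub>R (\<Sum>j\<in>{1..<Suc n}. \<delta> j)) (u n) - \<omega> (u n)" for n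
  note n = is_normD[OF nrm]
  have u: "nrm (u n) \<le> 1" for n unfolding u_def by (rule prox_in_ball[OF nrm omega])
  have "V n \<le> (\<Sum>i=1..n. \<gamma> * inner (\<delta> i) (u (i - 1)) + \<gamma>\<^sup>2 / 2 * (conj_norm nrm (\<delta> i))\<^sup>2)" for n
  proof (induction n)
    case 0
    show ?case using omega_nonneg[OF nrm omega u[of 0]] by (simp add: V_def)
  next
    case (Suc n)
    let ?S = "\<gamma> *\<^sub>R (\<Sum>j\<in>{1..<Suc n}. \<delta> j)" and ?d = "\<delta> (Suc n)"
    let ?v = "u (Suc n)"
    have "V (Suc n) = inner ?S ?v - \<omega> ?v + \<gamma> * inner ?d (u n) + \<gamma> * inner ?d (?v - u n)"
      by (simp add: V_def inner_add_left inner_diff_right algebra_simps)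
    also have "inner ?S ?v - \<omega> ?v \<le> V n - (nrm (?v - u n))\<^sup>2 / 2"
      using prox_quadratic_growth[OF nrm omega u[of "Suc n"], of ?S] by (simp add: V_def u_def)
    also have "\<gamma> * inner ?d (?v - u n) \<le> \<gamma> * (nrm (?v - u n) * conj_norm nrm ?d)"
      using inner_le_conj_norm[OF nrm, of "?v - u n" ?d] \<gamma> by (intro mult_left_mono) (auto simp: inner_commute)
    \<comment> \<open>Young's inequality; the second summand is cancelled by the quadratic growth.\<close>
    also have "\<dots> \<le> \<gamma>\<^sup>2 / 2 * (conj_norm nrm ?d)\<^sup>2 + (nrm (?v - u n))\<^sup>2 / 2"
      using zero_le_power2[of "\<gamma> * conj_norm nrm ?d - nrm (?v - u n)"]
      by (simp add: power2_eq_square algebra_simps)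
    finally show ?case using Suc.IH by simp
  qed
  from this[of N] have VN: "V N \<le> \<gamma> * (\<Sum>i=1..N. inner (\<delta> i) (u (i - 1))) + \<gamma>\<^sup>2 / 2 * (\<Sum>i=1..N. (conj_norm nrm (\<delta> i))\<^sup>2)"
    by (simp add: sum.distrib sum_distrib_left)
  have "conj_norm nrm (\<Sum>i=1..N. \<delta> i) \<le> ((Omega nrm \<omega>)\<^sup>2 / 2 + V N) / \<gamma>"
  proof (rule conj_norm_le[OF nrm])
    fix x assume x: "nrm x \<le> 1"
    have "inner (\<gamma> *\<^sub>R (\<Sum>j\<in>{1..<Suc N}. \<delta> j)) x - \<omega> x + (nrm (x - u N))\<^sup>2 / 2 \<le> V N"
      unfolding V_def u_def by (rule prox_quadratic_growth[OF nrm omega x])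
    then have "inner (\<gamma> *\<^sub>R (\<Sum>j\<in>{1..<Suc N}. \<delta> j)) x \<le> \<omega> x + V N"
      using zero_le_power2[of "nrm (x - u N)"] by linarith
    then have "\<gamma> * inner x (\<Sum>i=1..N. \<delta> i) \<le> \<omega> x + V N"
      by (simp add: atLeastLessThanSuc_atLeastAtMost inner_commute)
    then show "inner x (\<Sum>i=1..N. \<delta> i) \<le> ((Omega nrm \<omega>)\<^sup>2 / 2 + V N) / \<gamma>"
      using omega_le_Omega[OF nrm omega x] \<gamma> by (simp add: field_simps)
  qed
  also have "\<dots> \<le> ((Omega nrm \<omega>)\<^sup>2 / 2 + (\<gamma> * (\<Sum>i=1..N. inner (\<delta> i) (u (i - 1))) + \<gamma>\<^sup>2 / 2 * (\<Sum>i=1..N. (conj_norm nrm (\<delta> i))\<^sup>2))) / \<gamma>"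
    using VN \<gamma> by (intro divide_right_mono) auto
  also have "\<dots> = (Omega nrm \<omega>)\<^sup>2 / (2 * \<gamma>) + (\<Sum>i=1..N. inner (\<delta> i) (u (i - 1)))
      + \<gamma> / 2 * (\<Sum>i=1..N. (conj_norm nrm (\<delta> i))\<^sup>2)"
    using \<gamma> by (simp add: field_simps power2_eq_square)
  also have "(\<Sum>i=1..N. inner (\<delta> i) (u (i - 1))) = (\<Sum>i=1..N. inner (\<delta> i) (prox nrm \<omega> (\<gamma> *\<^sub>R (\<Sum>j\<in>{1..<i}. \<delta> j))))"
    by (intro sum.cong refl) (auto simp: u_def)
  finally show ?thesis .
qed

section \<open>Directional derivatives of convex functions\<close>

text \<open>For convex \<open>\<phi>\<close> the difference quotients increase with the step, so this infimum is the right-hand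
  directional derivative.\<close>

definition dirder :: "('a::real_vector \<Rightarrow> real) \<Rightarrow> 'a \<Rightarrow> 'a \<Rightarrow> real" where
  "dirder \<phi> x d = (INF s\<in>{0<..}. (\<phi> (x + s *\<^sub>R d) - \<phi> x) / s)"

lemma convex_slope_mono:
  fixes \<phi> :: "'a::real_vector \<Rightarrow> real"
  assumes conv: "convex_on UNIV \<phi>" and st: "0 < s" "s \<le> t"
  shows "(\<phi> (x + s *\<^sub>R d) - \<phi> x) / s \<le> (\<phi> (x + t *\<^sub>R d) - \<phi> x) / t"
proof -
  have "x + s *\<^sub>R d = (1 - s / t) *\<^sub>R x + (s / t) *\<^sub>R (x + t *\<^sub>R d)"
    using st by (simp add: algebra_simps)
  then have "\<phi> (x + s *\<^sub>R d) \<le> (1 - s / t) * \<phi> x + (s / t) * \<phi> (x + t *\<^sub>R d)"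
    using st convex_onD[OF conv, of "s / t" x "x + t *\<^sub>R d"] by simp
  then show ?thesis using st by (simp add: field_simps)
qed

text \<open>The point \<open>x\<close> is a convex combination of \<open>x + s d\<close> and \<open>x - d\<close>. The bound does not depend on \<open>s\<close>:
  it makes the infimum in \<open>dirder\<close> finite and serves as an integrable minorant of the quotients.\<close>

lemma convex_slope_lower:
  fixes \<phi> :: "'a::real_vector \<Rightarrow> real"
  assumes conv: "convex_on UNIV \<phi>" and s: "0 < s"
  shows "\<phi> x - \<phi> (x - d) \<le> (\<phi> (x + s *\<^sub>R d) - \<phi> x) / s"
proof -
  have "x = (1 - s / (1 + s)) *\<^sub>R (x + s *\<^sub>R d) + (s / (1 + s)) *\<^sub>R (x - d)"
  proof -
    have "(1 + s) *\<^sub>R ((1 - s / (1 + s)) *\<^sub>R (x + s *\<^sub>R d) + (s / (1 + s)) *\<^sub>R (x - d))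
        = 1 *\<^sub>R (x + s *\<^sub>R d) + s *\<^sub>R (x - d)"
      unfolding scaleR_add_right scaleR_scaleR using s by (simp add: field_simps)
    also have "\<dots> = (1 + s) *\<^sub>R x" by (simp add: algebra_simps)
    finally show ?thesis using s by (simp add: scaleR_left_imp_eq)
  qed
  then have "\<phi> x \<le> (1 - s / (1 + s)) * \<phi> (x + s *\<^sub>R d) + (s / (1 + s)) * \<phi> (x - d)"
    using s convex_onD[OF conv, of "s / (1 + s)" "x + s *\<^sub>R d" "x - d"] by simp
  moreover have "1 - s / (1 + s) = 1 / (1 + s)" using s by (simp add: field_simps)
  ultimately have "\<phi> x \<le> (\<phi> (x + s *\<^sub>R d) + s * \<phi> (x - d)) / (1 + s)" by (simp add: add_divide_distrib)
  then have "(1 + s) * \<phi> x \<le> \<phi> (x + s *\<^sub>R d) + s * \<phi> (x - d)" using s by (simp add: pos_le_divide_eq mult.commute)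
  then show ?thesis using s by (simp add: field_simps)
qed

lemma dirder_tendsto:
  fixes \<phi> :: "'a::real_vector \<Rightarrow> real"
  assumes conv: "convex_on UNIV \<phi>"
  shows "((\<lambda>s. (\<phi> (x + s *\<^sub>R d) - \<phi> x) / s) \<longlongrightarrow> dirder \<phi> x d) (at_right 0)"
    and dirder_le_slope: "0 < s \<Longrightarrow> dirder \<phi> x d \<le> (\<phi> (x + s *\<^sub>R d) - \<phi> x) / s"
proof -
  let ?\<sigma> = "\<lambda>s. (\<phi> (x + s *\<^sub>R d) - \<phi> x) / s"
  have bdd: "bdd_below (?\<sigma> ` {0<..})"
    using convex_slope_lower[OF conv] by (auto intro!: bdd_belowI2)
  have low: "dirder \<phi> x d \<le> ?\<sigma> s" if "0 < s" for s
    unfolding dirder_def using that by (intro cINF_lower bdd) auto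
  then show "0 < s \<Longrightarrow> dirder \<phi> x d \<le> ?\<sigma> s" .
  show "(?\<sigma> \<longlongrightarrow> dirder \<phi> x d) (at_right 0)"
  proof (rule order_tendstoI)
    fix a assume "a < dirder \<phi> x d"
    then show "eventually (\<lambda>s. a < ?\<sigma> s) (at_right 0)"
      unfolding eventually_at_right_field by (intro exI[of _ 1]) (auto intro: less_le_trans[OF _ low])
  next
    fix a assume "dirder \<phi> x d < a"
    then obtain t where t: "0 < t" "?\<sigma> t < a"
      unfolding dirder_def using cINF_less_iff[OF _ bdd, of a] by auto
    have "?\<sigma> s < a" if "0 < s" "s < t" for s
      using convex_slope_mono[OF conv, of s t x d] that t(2) by linarith
    then show "eventually (\<lambda>s. ?\<sigma> s < a) (at_right 0)"
      unfolding eventually_at_right_field using t(1) by (intro exI[of _ t]) auto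
  qed
qed

lemma dirder_LIMSEQ:
  fixes \<phi> :: "'a::real_vector \<Rightarrow> real"
  assumes "convex_on UNIV \<phi>"
  shows "(\<lambda>n. (\<phi> (x + inverse (real (Suc n)) *\<^sub>R d) - \<phi> x) / inverse (real (Suc n))) \<longlonglongrightarrow> dirder \<phi> x d"
proof -
  have "filterlim (\<lambda>n. inverse (real (Suc n))) (at_right 0) sequentially"
    by (intro tendsto_imp_filterlim_at_right LIMSEQ_inverse_real_of_nat) auto
  from filterlim_compose[OF dirder_tendsto(1)[OF assms] this] show ?thesis .
qed

lemma dirder_scaleR:
  fixes \<phi> :: "'a::real_vector \<Rightarrow> real"
  assumes conv: "convex_on UNIV \<phi>" and c: "0 \<le> c"
  shows "dirder \<phi> x (c *\<^sub>R d) = c * dirder \<phi> x d"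
proof (cases "c = 0")
  case True
  then show ?thesis by (simp add: dirder_def)
next
  case False
  with c have "0 < c" by simp
  have lim: "filterlim (\<lambda>s. c * s) (at_right 0) (at_right 0)"
  proof (rule tendsto_imp_filterlim_at_right)
    have "((\<lambda>s. c * s) \<longlongrightarrow> c * 0) (at_right 0)" by (intro tendsto_intros)
    then show "((\<lambda>s. c * s) \<longlongrightarrow> 0) (at_right 0)" by simp
    show "eventually (\<lambda>s. c * s > 0) (at_right 0)"
      unfolding eventually_at_right_field using \<open>0 < c\<close> by (intro exI[of _ 1]) auto
  qed
  have "((\<lambda>s. c * ((\<phi> (x + (c * s) *\<^sub>R d) - \<phi> x) / (c * s))) \<longlongrightarrow> c * dirder \<phi> x d) (at_right 0)"
    by (intro tendsto_mult tendsto_const filterlim_compose[OF dirder_tendsto(1)[OF conv] lim])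
  then have "((\<lambda>s. (\<phi> (x + s *\<^sub>R (c *\<^sub>R d)) - \<phi> x) / s) \<longlongrightarrow> c * dirder \<phi> x d) (at_right 0)"
    using \<open>0 < c\<close> by (simp add: mult_ac)
  from tendsto_unique[OF _ dirder_tendsto(1)[OF conv] this] show ?thesis by simp
qed

lemma dirder_add:
  fixes \<phi> :: "'a::real_vector \<Rightarrow> real"
  assumes conv: "convex_on UNIV \<phi>"
  shows "dirder \<phi> x (d + e) \<le> dirder \<phi> x d + dirder \<phi> x e"
proof -
  let ?\<sigma> = "\<lambda>d s. (\<phi> (x + s *\<^sub>R d) - \<phi> x) / s"
  have "((\<lambda>s. (?\<sigma> (2 *\<^sub>R d) s + ?\<sigma> (2 *\<^sub>R e) s) / 2) \<longlongrightarrow>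
      (dirder \<phi> x (2 *\<^sub>R d) + dirder \<phi> x (2 *\<^sub>R e)) / 2) (at_right 0)"
    by (intro tendsto_intros dirder_tendsto(1)[OF conv]) simp
  moreover have "?\<sigma> (d + e) s \<le> (?\<sigma> (2 *\<^sub>R d) s + ?\<sigma> (2 *\<^sub>R e) s) / 2" if "0 < s" for s
  proof -
    have "x + s *\<^sub>R (d + e) = (1 - 1 / 2) *\<^sub>R (x + s *\<^sub>R (2 *\<^sub>R d)) + (1 / 2) *\<^sub>R (x + s *\<^sub>R (2 *\<^sub>R e))"
      using scaleR_left_distrib[of "1 / 2" "1 / 2" x] by (simp add: algebra_simps)
    then have "\<phi> (x + s *\<^sub>R (d + e)) \<le> (1 - 1 / 2) * \<phi> (x + s *\<^sub>R (2 *\<^sub>R d)) + (1 / 2) * \<phi> (x + s *\<^sub>R (2 *\<^sub>R e))"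
      using convex_onD[OF conv, of "1 / 2"] by simp
    then have "?\<sigma> (d + e) s \<le> ((1 - 1 / 2) * \<phi> (x + s *\<^sub>R (2 *\<^sub>R d)) + (1 / 2) * \<phi> (x + s *\<^sub>R (2 *\<^sub>R e)) - \<phi> x) / s"
      using that by (intro divide_right_mono) auto
    also have "\<dots> = (?\<sigma> (2 *\<^sub>R d) s + ?\<sigma> (2 *\<^sub>R e) s) / 2" using that by (simp add: field_simps)
    finally show ?thesis .
  qed
  then have "eventually (\<lambda>s. ?\<sigma> (d + e) s \<le> (?\<sigma> (2 *\<^sub>R d) s + ?\<sigma> (2 *\<^sub>R e) s) / 2) (at_right 0)"
    unfolding eventually_at_right_field by (intro exI[of _ 1]) auto
  ultimately have "dirder \<phi> x (d + e) \<le> (dirder \<phi> x (2 *\<^sub>R d) + dirder \<phi> x (2 *\<^sub>R e)) / 2"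
    by (intro tendsto_le[OF _ _ dirder_tendsto(1)[OF conv]]) auto
  then show ?thesis by (simp add: dirder_scaleR[OF conv])
qed

lemma dirder_neg:
  fixes \<phi> :: "'a::real_vector \<Rightarrow> real"
  assumes conv: "convex_on UNIV \<phi>"
  shows "0 \<le> dirder \<phi> x d + dirder \<phi> x (- d)"
  using dirder_add[OF conv, of x d "- d"] dirder_scaleR[OF conv, of 0 x d] by simp

lemma dirder_sum_le:
  fixes \<phi> :: "'a::real_vector \<Rightarrow> real"
  assumes conv: "convex_on UNIV \<phi>" and "finite B"
  shows "dirder \<phi> x (\<Sum>b\<in>B. f b) \<le> (\<Sum>b\<in>B. dirder \<phi> x (f b))"
  using \<open>finite B\<close>
proof (induction B)
  case empty
  then show ?case using dirder_scaleR[OF conv, of 0] by simp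
next
  case (insert b B)
  then show ?case using dirder_add[OF conv, of x "f b" "\<Sum>b\<in>B. f b"] by simp
qed

text \<open>A sublinear function that is odd on a basis is linear. So the vector of directional derivatives
  along the basis represents all directional derivatives, which minorise the increments of \<open>\<phi>\<close>.\<close>

lemma dirder_gradient_in_subdifferential:
  fixes \<phi> :: "'a::euclidean_space \<Rightarrow> real"
  assumes conv: "convex_on UNIV \<phi>"
    and lin: "\<And>b. b \<in> Basis \<Longrightarrow> dirder \<phi> x b + dirder \<phi> x (- b) = 0"
  shows "(\<Sum>b\<in>Basis. dirder \<phi> x b *\<^sub>R b) \<in> subdifferential \<phi> x"
proof -
  have scale: "dirder \<phi> x (c *\<^sub>R b) = c * dirder \<phi> x b" if b: "b \<in> Basis" for b c
  proof (cases "0 \<le> c")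
    case True
    then show ?thesis by (rule dirder_scaleR[OF conv])
  next
    case False
    then have "dirder \<phi> x ((- c) *\<^sub>R (- b)) = (- c) * dirder \<phi> x (- b)" by (intro dirder_scaleR[OF conv]) simp
    moreover have "dirder \<phi> x (- b) = - dirder \<phi> x b" using lin[OF b] by linarith
    ultimately show ?thesis by simp
  qed
  have up: "dirder \<phi> x d \<le> (\<Sum>b\<in>Basis. (d \<bullet> b) * dirder \<phi> x b)" for d
  proof -
    have "dirder \<phi> x d = dirder \<phi> x (\<Sum>b\<in>Basis. (d \<bullet> b) *\<^sub>R b)" by (simp add: euclidean_representation)
    also have "\<dots> \<le> (\<Sum>b\<in>Basis. dirder \<phi> x ((d \<bullet> b) *\<^sub>R b))" by (rule dirder_sum_le[OF conv]) simp
    also have "\<dots> = (\<Sum>b\<in>Basis. (d \<bullet> b) * dirder \<phi> x b)" by (simp add: scale)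
    finally show ?thesis .
  qed
  have "inner (\<Sum>b\<in>Basis. dirder \<phi> x b *\<^sub>R b) d \<le> \<phi> (x + d) - \<phi> x" for d
  proof -
    have "inner (\<Sum>b\<in>Basis. dirder \<phi> x b *\<^sub>R b) d = (\<Sum>b\<in>Basis. (d \<bullet> b) * dirder \<phi> x b)"
      by (simp add: inner_sum_left inner_commute[of d] mult.commute)
    also have "\<dots> = - (\<Sum>b\<in>Basis. ((- d) \<bullet> b) * dirder \<phi> x b)" by (simp add: sum_negf)
    also have "\<dots> \<le> dirder \<phi> x d" using up[of "- d"] dirder_neg[OF conv, of x d] by linarith
    also have "\<dots> \<le> \<phi> (x + d) - \<phi> x" using dirder_le_slope[OF conv, of 1 x d] by simp
    finally show ?thesis .
  qed
  from this[of "y - x" for y] show ?thesis by (simp add: subdifferential_def algebra_simps)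
qed

lemma dirder_eq_derivative:
  fixes \<phi> :: "'a::euclidean_space \<Rightarrow> real"
  assumes conv: "convex_on UNIV \<phi>" and der: "(\<phi> has_derivative \<phi>') (at x)"
  shows "dirder \<phi> x d = \<phi>' d"
proof -
  interpret \<phi>': bounded_linear \<phi>' using der by (rule has_derivative_bounded_linear)
  have "((\<lambda>s. x + s *\<^sub>R d) has_derivative (\<lambda>h. h *\<^sub>R d)) (at (0::real))"
    by (auto intro!: derivative_eq_intros)
  from has_derivative_compose[OF this, of \<phi> \<phi>'] der
  have "((\<lambda>s. \<phi> (x + s *\<^sub>R d)) has_derivative (\<lambda>h. h * \<phi>' d)) (at 0)"
    by (simp add: \<phi>'.scaleR)
  then have "((\<lambda>s. \<phi> (x + s *\<^sub>R d)) has_field_derivative \<phi>' d) (at 0)"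
    by (simp add: has_field_derivative_def mult_commute_abs)
  then have "((\<lambda>s. (\<phi> (x + s *\<^sub>R d) - \<phi> x) / s) \<longlongrightarrow> \<phi>' d) (at 0)"
    by (simp add: has_field_derivative_iff)
  then have "((\<lambda>s. (\<phi> (x + s *\<^sub>R d) - \<phi> x) / s) \<longlongrightarrow> \<phi>' d) (at_right 0)"
    by (rule tendsto_within_subset) simp
  from tendsto_unique[OF _ dirder_tendsto(1)[OF conv] this] show ?thesis by simp
qed

lemma convex_on_UNIV_continuous:
  fixes \<phi> :: "'a::euclidean_space \<Rightarrow> real"
  shows "convex_on UNIV \<phi> \<Longrightarrow> continuous_on S \<phi>"
  using convex_on_continuous[of UNIV \<phi>] continuous_on_subset by blast

lemma bounded_subdifferential:
  fixes \<phi> :: "'a::euclidean_space \<Rightarrow> real"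
  assumes conv: "convex_on UNIV \<phi>"
  shows "bounded (subdifferential \<phi> x)"
proof -
  have "bounded (\<phi> ` cball x 1)"
    by (intro compact_imp_bounded compact_continuous_image convex_on_UNIV_continuous conv) simp
  then obtain B where B: "\<And>y. y \<in> cball x 1 \<Longrightarrow> \<bar>\<phi> y\<bar> \<le> B" by (auto simp: bounded_iff simp del: mem_cball)
  show ?thesis
  proof (rule boundedI)
    fix g assume g: "g \<in> subdifferential \<phi> x"
    have "\<phi> (x + sgn g) \<ge> \<phi> x + inner g (sgn g)" using g unfolding subdifferential_def by (metis (mono_tags, lifting) add_diff_cancel_left' mem_Collect_eq)
    moreover have "inner g (sgn g) = norm g"
      by (cases "g = 0") (simp_all add: sgn_div_norm power2_norm_eq_inner[symmetric] power2_eq_square)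
    moreover have "\<bar>\<phi> (x + sgn g)\<bar> \<le> B" "\<bar>\<phi> x\<bar> \<le> B"
      by (intro B; simp add: dist_norm norm_sgn)+
    ultimately show "norm g \<le> 2 * B" by linarith
  qed
qed

section \<open>Stochastic subgradients and sample average optima\<close>

text \<open>By second countability the complement of the support is covered by countably many null sets.\<close>

lemma AE_supp:
  fixes P :: "'b::second_countable_topology measure"
  assumes "sets P = sets borel"
  shows "AE z in P. z \<in> supp P"
proof -
  obtain B :: "'b set set" where B: "countable B" "topological_basis B"
    using ex_countable_basis by blast
  let ?N = "\<Union>{U\<in>B. emeasure P U = 0}"
  have "U \<in> sets P" if "U \<in> B" for U
    using topological_basis_open[OF B(2) that] assms by auto
  then have "?N \<in> null_sets P"
    using B(1) by (intro null_sets_UN'[of _ id, simplified]) auto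
  moreover have "{z \<in> space P. \<not> z \<in> supp P} \<subseteq> ?N"
  proof safe
    fix z assume "z \<notin> supp P"
    then obtain U where U: "open U" "z \<in> U" "emeasure P U = 0"
      by (auto simp: supp_def zero_less_iff_neq_zero)
    then obtain V where V: "V \<in> B" "z \<in> V" "V \<subseteq> U" using topological_basisE[OF B(2)] by metis
    have "emeasure P V \<le> emeasure P U" using V(3) U(1) assms by (intro emeasure_mono) auto
    then show "z \<in> ?N" using V U(3) by auto
  qed
  ultimately show ?thesis by (rule AE_I')
qed

text \<open>Extension of the integrand by 0 beyond the support, so that convexity and measurability hold
  everywhere.\<close>

definition on_supp :: "'b::topological_space measure \<Rightarrow> ('a \<Rightarrow> 'b \<Rightarrow> real) \<Rightarrow> 'a \<Rightarrow> 'b \<Rightarrow> real" where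
  "on_supp P F x z = indicator (supp P) z *\<^sub>R F x z"

lemma on_supp_facts:
  assumes conv: "\<forall>z\<in>supp P. convex_on UNIV (\<lambda>x. F x z)" and int: "\<forall>x. set_integrable P (supp P) (F x)"
  shows on_supp_eq: "z \<in> supp P \<Longrightarrow> on_supp P F x z = F x z"
    and on_supp_convex: "convex_on UNIV (\<lambda>x. on_supp P F x z)"
    and on_supp_integrable: "integrable P (on_supp P F x)"
    and expected_eq: "expected P F x = (LINT z|P. on_supp P F x z)"
proof -
  show "z \<in> supp P \<Longrightarrow> on_supp P F x z = F x z" by (simp add: on_supp_def)
  show "convex_on UNIV (\<lambda>x. on_supp P F x z)"
    using conv by (cases "z \<in> supp P") (auto simp: on_supp_def convex_on_const)
  show "integrable P (on_supp P F x)"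
    using int unfolding set_integrable_def on_supp_def[abs_def] by simp
  show "expected P F x = (LINT z|P. on_supp P F x z)"
    by (simp add: expected_def set_lebesgue_integral_def on_supp_def)
qed

lemma expected_convex:
  fixes F :: "'a::real_vector \<Rightarrow> 'b::topological_space \<Rightarrow> real"
  assumes "\<forall>z\<in>supp P. convex_on UNIV (\<lambda>x. F x z)" "\<forall>x. set_integrable P (supp P) (F x)"
  shows "convex_on UNIV (expected P F)"
proof (intro convex_onI)
  note facts = on_supp_facts[OF assms]
  fix t :: real and x y :: 'a assume t: "0 < t" "t < 1"
  have "(LINT z|P. on_supp P F ((1 - t) *\<^sub>R x + t *\<^sub>R y) z)
      \<le> (LINT z|P. (1 - t) * on_supp P F x z + t * on_supp P F y z)"
    using t by (intro integral_mono facts Bochner_Integration.integrable_add integrable_mult_right convex_onD[OF facts(2)]) auto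
  then show "expected P F ((1 - t) *\<^sub>R x + t *\<^sub>R y) \<le> (1 - t) * expected P F x + t * expected P F y"
    by (simp add: facts(3,4))
qed simp

text \<open>Dominated convergence: difference quotients with step at most 1 lie between
  \<open>G x - G (x - d)\<close> and \<open>G (x + d) - G x\<close>, both integrable.\<close>

lemma integral_dirder:
  fixes F :: "'a::real_vector \<Rightarrow> 'b::topological_space \<Rightarrow> real"
  assumes "\<forall>z\<in>supp P. convex_on UNIV (\<lambda>x. F x z)" "\<forall>x. set_integrable P (supp P) (F x)"
  shows "integrable P (\<lambda>z. dirder (\<lambda>y. on_supp P F y z) x d)"
    and "(LINT z|P. dirder (\<lambda>y. on_supp P F y z) x d) = dirder (expected P F) x d"
proof -
  note facts = on_supp_facts[OF assms]
  define G where "G = on_supp P F"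
  have G: "integrable P (G y)" "convex_on UNIV (\<lambda>y. G y z)" for y z
    unfolding G_def by (rule facts)+
  have [measurable]: "G y \<in> borel_measurable P" for y using G(1) by auto
  define s where "s n = inverse (real (Suc n))" for n
  have s: "0 < s n" "s n \<le> 1" for n by (auto simp: s_def inverse_le_1_iff)
  define \<sigma> where "\<sigma> n z = (G (x + s n *\<^sub>R d) z - G x z) / s n" for n z
  define w where "w z = \<bar>G (x + d) z - G x z\<bar> + \<bar>G x z - G (x - d) z\<bar>" for z
  have lim: "(\<lambda>n. \<sigma> n z) \<longlonglongrightarrow> dirder (\<lambda>y. G y z) x d" for z
    unfolding \<sigma>_def s_def by (rule dirder_LIMSEQ[OF G(2)])
  have [measurable]: "\<sigma> n \<in> borel_measurable P" for n unfolding \<sigma>_def by measurable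
  have [measurable]: "(\<lambda>z. dirder (\<lambda>y. G y z) x d) \<in> borel_measurable P"
    by (rule borel_measurable_LIMSEQ_real[OF lim]) measurable
  have w: "integrable P w" unfolding w_def using G(1) by auto
  have bound: "\<bar>\<sigma> n z\<bar> \<le> w z" for n z
    using convex_slope_mono[OF G(2)[of z] s[of n], of x d] convex_slope_lower[OF G(2)[of z] s(1)[of n], of x d]
    by (simp add: \<sigma>_def w_def)
  show "integrable P (\<lambda>z. dirder (\<lambda>y. on_supp P F y z) x d)"
    unfolding G_def[symmetric]
    by (rule integrable_dominated_convergence[where w = w and s = \<sigma>]) (use w lim bound in auto)
  have "(\<lambda>n. LINT z|P. \<sigma> n z) \<longlonglongrightarrow> (LINT z|P. dirder (\<lambda>y. G y z) x d)"
    by (rule integral_dominated_convergence[where w = w]) (use w lim bound in auto)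
  moreover have "(LINT z|P. \<sigma> n z) = (expected P F (x + s n *\<^sub>R d) - expected P F x) / s n" for n
    using G(1) by (simp add: \<sigma>_def facts(4) G_def)
  ultimately show "(LINT z|P. dirder (\<lambda>y. on_supp P F y z) x d) = dirder (expected P F) x d"
    using dirder_LIMSEQ[OF expected_convex[OF assms], of x d]
    unfolding G_def[symmetric] by (auto simp: s_def intro: LIMSEQ_unique)
qed

text \<open>For each basis vector \<open>b\<close> the nonnegative variable \<open>dirder b + dirder (- b)\<close> has mean
  \<open>\<langle>h, b\<rangle> + \<langle>h, - b\<rangle> = 0\<close>, hence vanishes almost surely. The vector \<open>g\<close> of the directional
  derivatives along the basis is then a subgradient; it is measurable as a limit of difference
  quotients, and its mean is the gradient \<open>h\<close> of the expectation.\<close>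

lemma unbiased_stochastic_gradient:
  fixes F :: "'a::euclidean_space \<Rightarrow> 'b::second_countable_topology \<Rightarrow> real"
  assumes sets_P: "sets P = sets borel"
    and F: "\<forall>z\<in>supp P. convex_on UNIV (\<lambda>x. F x z)" "\<forall>x. set_integrable P (supp P) (F x)"
    and diff: "expected P F differentiable (at x)"
  shows "\<exists>g h. (expected P F has_derivative (\<lambda>d. inner h d)) (at x) \<and> h \<in> subdifferential (expected P F) x
    \<and> g \<in> borel_measurable P \<and> (AE z in P. z \<in> supp P \<and> g z \<in> subdifferential (\<lambda>y. F y z) x)
    \<and> (\<forall>w. integrable P (\<lambda>z. inner (g z) w) \<and> (LINT z|P. inner (g z) w) = inner h w)"
proof -
  note facts = on_supp_facts[OF F]
  note conv = expected_convex[OF F]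
  define G where "G = on_supp P F"
  let ?p = "\<lambda>d z. dirder (\<lambda>y. G y z) x d"
  obtain f' where f': "(expected P F has_derivative f') (at x)" using diff unfolding differentiable_def by blast
  then interpret f': bounded_linear f' by (rule has_derivative_bounded_linear)
  define h where "h = adjoint f' 1"
  have h: "f' d = inner h d" for d
    using adjoint_works[OF f'.linear_axioms, of d 1] by (simp add: h_def inner_commute)
  have df: "dirder (expected P F) x d = inner h d" for d
    using dirder_eq_derivative[OF conv f'] by (simp add: h)
  have p: "integrable P (?p d)" "(LINT z|P. ?p d z) = inner h d" for d
    using integral_dirder[OF F, of x d] by (simp_all add: G_def df)
  have hsub: "h \<in> subdifferential (expected P F) x"
  proof -
    have "inner h (y - x) \<le> expected P F y - expected P F x" for y
      using dirder_le_slope[OF conv, of 1 x "y - x"] by (simp add: df)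
    from this show ?thesis by (simp add: subdifferential_def algebra_simps)
  qed
  define g where "g z = (\<Sum>b\<in>Basis. ?p b z *\<^sub>R b)" for z
  have gm: "g \<in> borel_measurable P"
    unfolding g_def using p(1) by (intro borel_measurable_sum borel_measurable_scaleR) auto
  have "AE z in P. ?p b z + ?p (- b) z = 0" for b
  proof -
    have "(LINT z|P. ?p b z + ?p (- b) z) = 0" using p by simp
    then show ?thesis
      using p dirder_neg[OF facts(2)]
      by (subst (asm) integral_nonneg_eq_0_iff_AE) (auto simp: G_def)
  qed
  then have "AE z in P. \<forall>b\<in>Basis. ?p b z + ?p (- b) z = 0" by (intro AE_finite_allI) auto
  then have gsub: "AE z in P. z \<in> supp P \<and> g z \<in> subdifferential (\<lambda>y. F y z) x"
    using AE_supp[OF sets_P]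
  proof eventually_elim
    case (elim z)
    then have "g z \<in> subdifferential (\<lambda>y. G y z) x"
      unfolding g_def G_def by (intro dirder_gradient_in_subdifferential facts(2)) auto
    then show ?case using elim by (simp add: G_def facts(1))
  qed
  have inner_g: "inner (g z) w = (\<Sum>b\<in>Basis. inner w b * ?p b z)" for z w
    by (simp add: g_def inner_sum_left inner_commute[of w] mult.commute)
  have "integrable P (\<lambda>z. inner (g z) w)" for w
    unfolding inner_g using p(1) by (intro Bochner_Integration.integrable_sum integrable_mult_right)
  moreover have "(LINT z|P. inner (g z) w) = inner h w" for w
  proof -
    have "(LINT z|P. inner (g z) w) = (\<Sum>b\<in>Basis. inner w b * inner h b)"
      unfolding inner_g using p by (subst Bochner_Integration.integral_sum) auto
    also have "\<dots> = inner h w" by (simp add: euclidean_inner[of h w] mult.commute)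
    finally show ?thesis .
  qed
  moreover have "(expected P F has_derivative (\<lambda>d. inner h d)) (at x)"
  proof -
    have "f' = (\<lambda>d. inner h d)" by (rule ext) (rule h)
    with f' show ?thesis by simp
  qed
  ultimately show ?thesis using hsub gm gsub by blast
qed

text \<open>Subdifferentials of finite convex functions are bounded, so the supremum in \<open>Lmax\<close> is taken over
  a bounded set and dominates each of its members.\<close>

lemma conj_norm_le_Lmax:
  fixes nrm :: "'a::euclidean_space \<Rightarrow> real"
  assumes nrm: "is_norm nrm" and conv: "convex_on UNIV (\<lambda>y. F y z)" "convex_on UNIV (expected P F)"
    and g: "g \<in> subdifferential (\<lambda>y. F y z) x" and h: "h \<in> subdifferential (expected P F) x"
  shows "conj_norm nrm (g - h) \<le> Lmax nrm P F x z"
proof -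
  obtain B1 where B1: "\<And>g. g \<in> subdifferential (\<lambda>y. F y z) x \<Longrightarrow> norm g \<le> B1"
    using bounded_subdifferential[OF conv(1), of x] by (auto simp: bounded_iff)
  obtain B2 where B2: "\<And>g. g \<in> subdifferential (expected P F) x \<Longrightarrow> norm g \<le> B2"
    using bounded_subdifferential[OF conv(2), of x] by (auto simp: bounded_iff)
  obtain K where K: "0 < K" "\<And>y. conj_norm nrm y \<le> K * norm y" using conj_norm_le_norm[OF nrm] by blast
  show ?thesis
    unfolding Lmax_def
  proof (rule cSup_upper)
    have "conj_norm nrm (g - h) \<le> K * (B1 + B2)"
      if "g \<in> subdifferential (\<lambda>y. F y z) x" "h \<in> subdifferential (expected P F) x" for g h
      using K(1) B1[OF that(1)] B2[OF that(2)] norm_triangle_ineq4[of g h]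
      by (intro order_trans[OF K(2)] mult_left_mono) auto
    then show "bdd_above {conj_norm nrm (g - h) |g h. g \<in> subdifferential (\<lambda>y. F y z) x \<and> h \<in> subdifferential (expected P F) x}"
      by (auto intro!: bdd_aboveI[of _ "K * (B1 + B2)"])
  qed (use g h in blast)
qed

lemma Opt_attained:
  fixes X :: "'a::euclidean_space set"
  assumes X: "X \<noteq> {}" "compact X" and conv: "convex_on UNIV (expected P F)"
  obtains x where "x \<in> X" "Opt P F X = expected P F x" "\<And>y. y \<in> X \<Longrightarrow> expected P F x \<le> expected P F y"
proof -
  obtain x where x: "x \<in> X" "\<And>y. y \<in> X \<Longrightarrow> expected P F x \<le> expected P F y"
    using continuous_attains_inf[OF X(2,1) convex_on_UNIV_continuous[OF conv]] by blast
  have "Opt P F X = expected P F x"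
    unfolding Opt_def using x by (intro cInf_eq_minimum) auto
  with that x show ?thesis by blast
qed

lemma OptN_le:
  fixes X :: "'a::euclidean_space set"
  assumes X: "compact X" "x \<in> X" and conv: "\<And>t. t \<in> {1..N} \<Longrightarrow> convex_on UNIV (\<lambda>y. F y (z t))"
  shows "OptN F X N z \<le> (1 / real N) * (\<Sum>t=1..N. F x (z t))"
proof -
  have "continuous_on X (\<lambda>x. (1 / real N) * (\<Sum>t=1..N. F x (z t)))"
    using conv by (intro continuous_intros convex_on_UNIV_continuous)
  then have "bdd_below ((\<lambda>x. (1 / real N) * (\<Sum>t=1..N. F x (z t))) ` X)"
    using X(1) by (intro bounded_imp_bdd_below compact_imp_bounded compact_continuous_image)
  then show ?thesis unfolding OptN_def using X(2) by (intro cINF_lower)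
qed

lemma gradient_at_minimum:
  fixes X :: "'a::euclidean_space set"
  assumes X: "convex X" "x \<in> X" "y \<in> X" and min: "\<And>y. y \<in> X \<Longrightarrow> f x \<le> f y"
    and conv: "convex_on UNIV f" and der: "(f has_derivative (\<lambda>d. inner h d)) (at x)"
  shows "0 \<le> inner h (y - x)"
proof -
  have "0 \<le> (f (x + s *\<^sub>R (y - x)) - f x) / s" if "0 < s" "s < 1" for s
  proof -
    have "x + s *\<^sub>R (y - x) = (1 - s) *\<^sub>R x + s *\<^sub>R y" by (simp add: algebra_simps)
    also have "\<dots> \<in> X" using X that by (intro convexD) auto
    finally show ?thesis using min that by simp
  qed
  then have "eventually (\<lambda>s. 0 \<le> (f (x + s *\<^sub>R (y - x)) - f x) / s) (at_right 0)"
    unfolding eventually_at_right_field by (intro exI[of _ 1]) auto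
  from tendsto_lowerbound[OF dirder_tendsto(1)[OF conv] this]
  show ?thesis by (simp add: dirder_eq_derivative[OF conv der])
qed

text \<open>The subgradient inequality at \<open>x\<close> is summed over the sample; the part of the gradients that
  comes from \<open>h\<close> is dropped since it is nonnegative on \<open>X\<close>. What remains is
  \<open>\<langle>\<Sum>\<delta>\<^sub>t, y - x\<rangle> = \<langle>\<Sum>\<delta>\<^sub>t, y - c\<rangle> - \<langle>\<Sum>\<delta>\<^sub>t, x - c\<rangle>\<close>, and only the first summand, bounded through the
  conjugate norm, depends on \<open>y\<close>.\<close>

lemma OptN_lower_bound:
  fixes X :: "'a::euclidean_space set"
  assumes nrm: "is_norm nrm" and X: "X \<noteq> {}" and N: "1 \<le> N"
    and ball: "\<And>y. y \<in> X \<Longrightarrow> nrm (y - c) \<le> R"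
    and h: "\<And>y. y \<in> X \<Longrightarrow> 0 \<le> inner h (y - x)"
    and g: "\<And>t. t \<in> {1..N} \<Longrightarrow> g (z t) \<in> subdifferential (\<lambda>y. F y (z t)) x"
  shows "(\<Sum>t=1..N. F x (z t)) - (R * conj_norm nrm (\<Sum>t=1..N. g (z t) - h) + inner (\<Sum>t=1..N. g (z t) - h) (x - c))
    \<le> real N * OptN F X N z"
proof -
  let ?S = "\<Sum>t=1..N. g (z t) - h"
  let ?lhs = "(\<Sum>t=1..N. F x (z t)) - (R * conj_norm nrm ?S + inner ?S (x - c))"
  have "?lhs / real N \<le> OptN F X N z"
    unfolding OptN_def
  proof (rule cINF_greatest[OF X])
    fix y assume y: "y \<in> X"
    have "(\<Sum>t=1..N. F x (z t) + inner (g (z t) - h) (y - x)) \<le> (\<Sum>t=1..N. F y (z t))"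
    proof (rule sum_mono)
      fix t assume "t \<in> {1..N}"
      then have "F x (z t) + inner (g (z t)) (y - x) \<le> F y (z t)" using g by (auto simp: subdifferential_def)
      then show "F x (z t) + inner (g (z t) - h) (y - x) \<le> F y (z t)"
        using h[OF y] by (simp add: inner_diff_left)
    qed
    also have "(\<Sum>t=1..N. F x (z t) + inner (g (z t) - h) (y - x)) = (\<Sum>t=1..N. F x (z t)) + inner ?S (y - x)"
      by (simp only: sum.distrib inner_sum_left)
    finally have 1: "(\<Sum>t=1..N. F x (z t)) + inner ?S (y - x) \<le> (\<Sum>t=1..N. F y (z t))" .
    have "inner (c - y) ?S \<le> nrm (c - y) * conj_norm nrm ?S" by (rule inner_le_conj_norm[OF nrm])
    also have "\<dots> \<le> R * conj_norm nrm ?S"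
      using ball[OF y] is_normD(8)[OF nrm, of c y] by (intro mult_right_mono conj_norm_nonneg nrm) simp
    finally have "- (R * conj_norm nrm ?S) \<le> inner ?S (y - c)"
      unfolding inner_commute[of ?S] inner_diff_left by linarith
    moreover have "inner ?S (y - x) = inner ?S (y - c) - inner ?S (x - c)" by (simp add: inner_diff_right)
    ultimately have "?lhs \<le> (\<Sum>t=1..N. F y (z t))" using 1 by linarith
    then have "?lhs / real N \<le> (\<Sum>t=1..N. F y (z t)) / real N" by (rule divide_right_mono) simp
    then show "?lhs / real N \<le> 1 / real N * (\<Sum>t=1..N. F y (z t))" by simp
  qed
  then show ?thesis using N by (simp add: pos_divide_le_eq mult.commute)
qed

section \<open>The confidence bounds\<close>

lemma prob_le_of_AE_cover3:
  assumes "prob_space M" and sets: "A \<in> sets M" "B \<in> sets M" "C \<in> sets M"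
    and sub: "AE w in M. w \<in> S \<longrightarrow> w \<in> A \<union> B \<union> C"
    and le: "measure M A \<le> a" "measure M B \<le> b" "measure M C \<le> c"
  shows "measure M S \<le> a + b + c"
proof -
  interpret prob_space M by fact
  have "measure M S \<le> measure M (A \<union> B \<union> C)"
    using sub sets by (intro finite_measure_mono_AE) auto
  also have "\<dots> \<le> measure M (A \<union> B) + measure M C" using sets by (intro measure_Un_le) auto
  also have "measure M (A \<union> B) \<le> measure M A + measure M B" using sets by (intro measure_Un_le) auto
  finally show ?thesis using le by linarith
qed

text \<open>The deterministic end of the lower bound, with \<open>n = \<surd>N\<close>: \<open>S\<close> stands for the sum of the
  \<open>F(x,\<xi>\<^sub>t)\<close>, \<open>D + I\<close> for \<open>\<parallel>\<Sum>\<delta>\<^sub>t\<parallel>\<^sub>* + \<langle>\<Sum>\<delta>\<^sub>t, v\<rangle>\<close>, \<open>Y\<close> for the martingale sum and \<open>L\<close> for the sum of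
  squares. The choice of \<open>\<gamma>\<close> yields the coefficient \<open>\<Omega> (1 + s\<^sup>2) / 2\<close>, at most the one in the bound.\<close>

lemma opt_lower_bound_of_deviations:
  fixes n :: real
  assumes n: "0 < n" and pos: "0 \<le> R" "0 < M2" "0 < \<Omega>"
    and F: "n\<^sup>2 * fx - S \<le> \<mu> * M1 * n"
    and D: "D + I \<le> \<Omega>\<^sup>2 / (2 * \<gamma>) + Y + \<gamma> / 2 * L"
    and \<gamma>: "\<gamma> = \<Omega> / (M2 * n)"
    and Y: "Y \<le> l * (2 * M2) * n" and L: "L / M2\<^sup>2 \<le> n\<^sup>2 * s\<^sup>2"
    and opt: "S - R * (D + I) \<le> n\<^sup>2 * opt"
  shows "fx - (\<mu> * M1 + (\<Omega> * (1 + s\<^sup>2) + 2 * l) * M2 * R) / n \<le> opt"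
proof -
  have "L \<le> M2\<^sup>2 * (n\<^sup>2 * s\<^sup>2)" using L pos by (simp add: pos_divide_le_eq mult.commute)
  then have "\<gamma> / 2 * L \<le> \<gamma> / 2 * (M2\<^sup>2 * (n\<^sup>2 * s\<^sup>2))"
    using pos n by (intro mult_left_mono) (auto simp: \<gamma>)
  also have "\<dots> = \<Omega> * s\<^sup>2 * M2 * n / 2" using pos n by (simp add: \<gamma> field_simps power2_eq_square)
  finally have 1: "\<gamma> / 2 * L \<le> \<Omega> * s\<^sup>2 * M2 * n / 2" .
  have 2: "\<Omega>\<^sup>2 / (2 * \<gamma>) = \<Omega> * M2 * n / 2" using pos n by (simp add: \<gamma> field_simps power2_eq_square)
  have "0 \<le> \<Omega> * M2 * n" "0 \<le> \<Omega> * s\<^sup>2 * M2 * n" using pos n by auto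
  then have "D + I \<le> (\<Omega> * (1 + s\<^sup>2) + 2 * l) * M2 * n"
    using D Y 1 unfolding 2 by (simp add: algebra_simps)
  then have "R * (D + I) \<le> R * ((\<Omega> * (1 + s\<^sup>2) + 2 * l) * M2 * n)" using pos by (intro mult_left_mono)
  then have "n\<^sup>2 * fx \<le> n\<^sup>2 * opt + n * (\<mu> * M1 + (\<Omega> * (1 + s\<^sup>2) + 2 * l) * M2 * R)"
    using F opt by (simp add: algebra_simps)
  then have "n * (n * fx) \<le> n * (n * opt + (\<mu> * M1 + (\<Omega> * (1 + s\<^sup>2) + 2 * l) * M2 * R))"
    by (simp add: algebra_simps power2_eq_square)
  then have "n * fx \<le> n * opt + (\<mu> * M1 + (\<Omega> * (1 + s\<^sup>2) + 2 * l) * M2 * R)"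
    using n by (simp only: mult_le_cancel_left_pos)
  then show ?thesis using n by (simp add: field_simps)
qed

theorem proposition1:
  fixes nrm :: "'a::euclidean_space \<Rightarrow> real"
    and \<omega> :: "'a \<Rightarrow> real"
    and X :: "'a set"
    and P :: "(real ^ 'k) measure"
    and F :: "'a \<Rightarrow> real ^ 'k \<Rightarrow> real"
    and M1 M2 :: real
    and M :: "'w measure"
    and \<xi> :: "nat \<Rightarrow> 'w \<Rightarrow> real ^ 'k"
  assumes nrm: "is_norm nrm"
    and omega: "distance_generating nrm \<omega>"
    and X: "X \<noteq> {}" "convex X" "compact X"
    and P: "prob_space P" "sets P = sets borel"
    and F_borel: "(\<lambda>(x, z). F x z) \<in> borel_measurable (restrict_space borel (UNIV \<times> supp P))"
    and F_convex: "\<forall>z\<in>supp P. convex_on UNIV (\<lambda>x. F x z)"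
    and F_summable: "\<forall>x. set_integrable P (supp P) (F x)"
    and M: "prob_space M"
    and xi_indep: "prob_space.indep_vars M (\<lambda>_. borel) \<xi> {1..}"
    and xi_distr: "\<forall>t\<ge>1. distr M borel (\<xi> t) = P"
    and f_diff: "\<forall>x\<in>X. expected P F differentiable (at x)"
    and M_pos: "M1 > 0" "M2 > 0"
    and exp_F: "\<forall>x\<in>X. (\<integral>\<^sup>+z\<in>supp P. ennreal (exp ((F x z - expected P F x)\<^sup>2 / M1\<^sup>2)) \<partial>P)
                  \<le> ennreal (exp 1)"
    and exp_L: "\<forall>x\<in>X. (\<integral>\<^sup>+z\<in>supp P. ennreal (exp ((Lmax nrm P F x z)\<^sup>2 / M2\<^sup>2)) \<partial>P)
                  \<le> ennreal (exp 1)"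
  shows "(\<forall>(N::nat) (\<mu>::real). 1 \<le> N \<longrightarrow> 0 \<le> \<mu> \<longrightarrow> \<mu> \<le> 2 * sqrt (tau_star * real N) \<longrightarrow>
            measure M {w \<in> space M. (\<forall>t\<in>{1..N}. \<xi> t w \<in> supp P) \<and>
                OptN F X N (\<lambda>t. \<xi> t w) > Opt P F X + a_bound M1 \<mu> N}
              \<le> exp (- (\<mu>\<^sup>2 / (4 * tau_star))))
       \<and> (\<forall>(N::nat) (\<mu>::real) (s::real) (l::real).
            1 \<le> N \<longrightarrow> 0 \<le> \<mu> \<longrightarrow> \<mu> \<le> 2 * sqrt (tau_star * real N) \<longrightarrow> 1 < s \<longrightarrow> 0 \<le> l \<longrightarrow>
            measure M {w \<in> space M. (\<forall>t\<in>{1..N}. \<xi> t w \<in> supp P) \<and>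
                OptN F X N (\<lambda>t. \<xi> t w)
                  < Opt P F X - b_bound M1 M2 (Omega nrm \<omega>) (min_radius nrm X) \<mu> s l N}
              \<le> exp (- (real N * (s\<^sup>2 - 1))) + exp (- (\<mu>\<^sup>2 / (4 * tau_star)))
                 + exp (- (l\<^sup>2 / (4 * tau_star))))"
proof -
  interpret P: prob_space P by fact
  interpret M: prob_space M by fact
  define f where "f = expected P F"
  define G where "G = on_supp P F"
  define \<Omega> where "\<Omega> = Omega nrm \<omega>"
  define R where "R = min_radius nrm X"
  note n = is_normD[OF nrm]
  note facts = on_supp_facts[OF F_convex F_summable]
  have f_conv: "convex_on UNIV f" unfolding f_def by (rule expected_convex[OF F_convex F_summable])
  obtain x where x: "x \<in> X" "Opt P F X = f x" "\<And>y. y \<in> X \<Longrightarrow> f x \<le> f y"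
    using Opt_attained[OF X(1,3) f_conv[unfolded f_def]] unfolding f_def by metis
  obtain g h where h: "(f has_derivative (\<lambda>d. inner h d)) (at x)" "h \<in> subdifferential f x"
    and g_meas [measurable]: "g \<in> borel_measurable P"
    and g_sub: "AE z in P. z \<in> supp P \<and> g z \<in> subdifferential (\<lambda>y. F y z) x"
    and g_int: "\<And>w. integrable P (\<lambda>z. inner (g z) w)" "\<And>w. (LINT z|P. inner (g z) w) = inner h w"
    using unbiased_stochastic_gradient[OF P(2) F_convex F_summable f_diff[rule_format, OF x(1)]]
    unfolding f_def by blast
  define \<delta> where "\<delta> z = g z - h" for z
  have \<delta>_meas [measurable]: "\<delta> \<in> borel_measurable P" unfolding \<delta>_def by measurable
  have Gx: "integrable P (G x)" "(LINT z|P. G x z) = f x"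
    using facts(3,4)[of x] by (simp_all add: G_def f_def)
  have [measurable]: "G x \<in> borel_measurable P" using Gx by auto
  have good: "AE w in M. \<forall>t\<in>{1..N}. \<xi> t w \<in> supp P \<and> g (\<xi> t w) \<in> subdifferential (\<lambda>y. F y (\<xi> t w)) x" for N
  proof (rule AE_finite_allI)
    fix t assume t: "t \<in> {1..N}"
    have "\<xi> t \<in> borel_measurable M" using xi_indep t unfolding M.indep_vars_def by auto
    moreover have "AE z in distr M borel (\<xi> t). z \<in> supp P \<and> g z \<in> subdifferential (\<lambda>y. F y z) x"
    proof -
      have "distr M borel (\<xi> t) = P" using xi_distr t by simp
      then show ?thesis using g_sub by (rule ssubst)
    qed
    ultimately show "AE w in M. \<xi> t w \<in> supp P \<and> g (\<xi> t w) \<in> subdifferential (\<lambda>y. F y (\<xi> t w)) x"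
      by (rule AE_distrD)
  qed simp
  have light_G: "(\<integral>\<^sup>+z. ennreal (exp ((G x z - f x)\<^sup>2 / M1\<^sup>2)) \<partial>P) \<le> ennreal (exp 1)"
  proof -
    have "(\<integral>\<^sup>+z. ennreal (exp ((G x z - f x)\<^sup>2 / M1\<^sup>2)) \<partial>P)
        \<le> (\<integral>\<^sup>+z\<in>supp P. ennreal (exp ((F x z - expected P F x)\<^sup>2 / M1\<^sup>2)) \<partial>P)"
      by (rule nn_integral_mono_AE) (use g_sub in eventually_elim, simp add: G_def f_def facts(1))
    then show ?thesis using exp_F x(1) by (auto intro: order_trans)
  qed
  \<comment> \<open>The integral over \<open>Lmax\<close> is a lower integral, which is monotone without any measurability.\<close>
  have light_\<delta>: "(\<integral>\<^sup>+z. ennreal (exp ((conj_norm nrm (\<delta> z))\<^sup>2 / M2\<^sup>2)) \<partial>P) \<le> ennreal (exp 1)"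
  proof -
    have "(\<integral>\<^sup>+z. ennreal (exp ((conj_norm nrm (\<delta> z))\<^sup>2 / M2\<^sup>2)) \<partial>P)
        \<le> (\<integral>\<^sup>+z\<in>supp P. ennreal (exp ((Lmax nrm P F x z)\<^sup>2 / M2\<^sup>2)) \<partial>P)"
    proof (rule nn_integral_mono_AE)
      show "AE z in P. ennreal (exp ((conj_norm nrm (\<delta> z))\<^sup>2 / M2\<^sup>2))
          \<le> ennreal (exp ((Lmax nrm P F x z)\<^sup>2 / M2\<^sup>2)) * indicator (supp P) z"
        using g_sub
      proof eventually_elim
        case (elim z)
        then have "conj_norm nrm (\<delta> z) \<le> Lmax nrm P F x z"
          unfolding \<delta>_def using F_convex f_conv h(2) by (intro conj_norm_le_Lmax[OF nrm]) (auto simp: f_def)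
        then have "(conj_norm nrm (\<delta> z))\<^sup>2 \<le> (Lmax nrm P F x z)\<^sup>2"
          by (intro power_mono conj_norm_nonneg nrm)
        then show ?case using elim by (auto intro!: ennreal_leI divide_right_mono)
      qed
    qed
    then show ?thesis using exp_L x(1) by (auto intro: order_trans)
  qed
  have upper: "measure M {w \<in> space M. (\<forall>t\<in>{1..N}. \<xi> t w \<in> supp P) \<and>
      OptN F X N (\<lambda>t. \<xi> t w) > Opt P F X + a_bound M1 \<mu> N} \<le> exp (- (\<mu>\<^sup>2 / (4 * tau_star)))"
    (is "measure M ?E \<le> _") if N: "1 \<le> N" and \<mu>: "0 \<le> \<mu>" for N \<mu>
  proof -
    let ?T = "{w \<in> space M. \<mu> * M1 * sqrt (real N) < (\<Sum>i=1..N. G x (\<xi> i w) - f x)}"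
    have meas: "(\<lambda>z. G x (z i) - f x) \<in> borel_measurable (PiM {1..n} (\<lambda>_. P))" if "i \<in> {1..n}" for i n
      using that by measurable
    have pred: "predictable (\<lambda>i z y. G x y - f x)" by (simp add: predictable_def)
    note data = P M xi_indep xi_distr
    have sets: "?T \<in> sets M"
      using adapted_sum_tail(1)[OF data _ pred N] meas by measurable
    have tail: "measure M ?T \<le> exp (- (\<mu>\<^sup>2 / (4 * tau_star)))"
      by (rule sub_gaussian_tail[OF data meas pred _ _ light_G M_pos(1) N \<mu>]) (use Gx P.prob_space in auto)
    have "?E \<subseteq> ?T"
    proof safe
      fix w assume w: "w \<in> space M" "\<forall>t\<in>{1..N}. \<xi> t w \<in> supp P"
        and opt: "Opt P F X + a_bound M1 \<mu> N < OptN F X N (\<lambda>t. \<xi> t w)"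
      have "OptN F X N (\<lambda>t. \<xi> t w) \<le> (1 / real N) * (\<Sum>t=1..N. F x (\<xi> t w))"
        using w F_convex x(1) by (intro OptN_le X(3)) auto
      also have "(\<Sum>t=1..N. F x (\<xi> t w)) = (\<Sum>t=1..N. G x (\<xi> t w))"
        using w by (intro sum.cong) (auto simp: G_def facts(1))
      finally have "f x + a_bound M1 \<mu> N < (1 / real N) * (\<Sum>t=1..N. G x (\<xi> t w))"
        using opt x(2) by linarith
      then have "real N * (f x + a_bound M1 \<mu> N) < (\<Sum>t=1..N. G x (\<xi> t w))"
        using N by (simp add: field_simps)
      moreover have "real N * a_bound M1 \<mu> N = \<mu> * M1 * sqrt (real N)"
        using N by (simp add: a_bound_def field_simps)
      ultimately show "\<mu> * M1 * sqrt (real N) < (\<Sum>i=1..N. G x (\<xi> i w) - f x)"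
        by (simp add: sum_subtractf algebra_simps)
    qed
    then have "measure M ?E \<le> measure M ?T" by (intro M.finite_measure_mono sets)
    with tail show ?thesis by simp
  qed
  have lower: "measure M {w \<in> space M. (\<forall>t\<in>{1..N}. \<xi> t w \<in> supp P) \<and>
      OptN F X N (\<lambda>t. \<xi> t w) < Opt P F X - b_bound M1 M2 \<Omega> R \<mu> s l N}
    \<le> exp (- (real N * (s\<^sup>2 - 1))) + exp (- (\<mu>\<^sup>2 / (4 * tau_star))) + exp (- (l\<^sup>2 / (4 * tau_star)))"
    (is "measure M ?E \<le> _") if N: "1 \<le> N" and \<mu>: "0 \<le> \<mu>" and l: "0 \<le> l" for N \<mu> s l
  proof -
    note data = P M xi_indep xi_distr
    obtain c where R: "0 \<le> R" and c: "\<And>y. y \<in> X \<Longrightarrow> nrm (y - c) \<le> R"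
      using min_radius_attained[OF nrm X(1,3)] unfolding R_def by metis
    \<comment> \<open>If \<open>R = 0\<close>, then \<open>x = c\<close>, and the default value 0 of the division gives \<open>v = 0\<close> as required.\<close>
    define v where "v = (1 / R) *\<^sub>R (x - c)"
    have v: "nrm v \<le> 1" "R *\<^sub>R v = x - c"
    proof -
      have "nrm (x - c) \<le> R" by (rule c[OF x(1)])
      moreover have "x - c = 0" if "R = 0"
        using calculation that n(1)[of "x - c"] n(3)[of "x - c"] by linarith
      ultimately show "nrm v \<le> 1" "R *\<^sub>R v = x - c"
        using R by (auto simp: v_def n(4) n(2) divide_le_eq_1)
    qed
    have \<Omega>: "0 < \<Omega>" unfolding \<Omega>_def by (rule Omega_pos[OF nrm omega])
    define \<gamma> where "\<gamma> = \<Omega> / (M2 * sqrt (real N))"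
    have \<gamma>: "0 < \<gamma>" using \<Omega> M_pos N by (simp add: \<gamma>_def)
    \<comment> \<open>The dual averaging iterate shifted by \<open>v\<close>: one martingale carries both linear terms, so that a
      single event of probability at most \<open>exp (- l\<^sup>2 / (4 tau_star))\<close> is spent on them.\<close>
    define u where "u i z = prox nrm \<omega> (\<gamma> *\<^sub>R (\<Sum>j\<in>{1..<i}. \<delta> (z j))) + v" for i and z :: "nat \<Rightarrow> real ^ 'k"
    have u: "nrm (u i z) \<le> 2" for i z
      using n(5)[of "prox nrm \<omega> (\<gamma> *\<^sub>R (\<Sum>j\<in>{1..<i}. \<delta> (z j)))" v]
        prox_in_ball[OF nrm omega, of "\<gamma> *\<^sub>R (\<Sum>j\<in>{1..<i}. \<delta> (z j))"] v(1)
      by (simp add: u_def)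
    have [measurable]: "conj_norm nrm \<in> borel_measurable borel" "prox nrm \<omega> \<in> borel_measurable borel"
      by (intro borel_measurable_continuous_onI continuous_on_conj_norm continuous_on_prox nrm omega)+

    \<comment> \<open>Deviation of the objective, martingale increments, and squared gradient noise.\<close>
    let ?YF = "\<lambda>i (z :: nat \<Rightarrow> real ^ 'k) y. f x - G x y"
    let ?YD = "\<lambda>i (z :: nat \<Rightarrow> real ^ 'k) y. inner (\<delta> y) (u i z)"
    let ?YL = "\<lambda>i (z :: nat \<Rightarrow> real ^ 'k) y. (conj_norm nrm (\<delta> y))\<^sup>2 / M2\<^sup>2"
    have pred: "predictable ?YF" "predictable ?YD" "predictable ?YL"
    proof -
      show "predictable ?YF" "predictable ?YL" by (simp_all add: predictable_def)
      show "predictable ?YD"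
        unfolding predictable_def u_def
      proof (intro allI impI)
        fix i y and z z' :: "nat \<Rightarrow> real ^ 'k"
        assume "\<forall>j\<in>{1..<i}. z j = z' j"
        then have "(\<Sum>j\<in>{1..<i}. \<delta> (z j)) = (\<Sum>j\<in>{1..<i}. \<delta> (z' j))" by (intro sum.cong) auto
        then show "inner (\<delta> y) (prox nrm \<omega> (\<gamma> *\<^sub>R (\<Sum>j\<in>{1..<i}. \<delta> (z j))) + v)
          = inner (\<delta> y) (prox nrm \<omega> (\<gamma> *\<^sub>R (\<Sum>j\<in>{1..<i}. \<delta> (z' j))) + v)" by simp
      qed
    qed
    have measF: "(\<lambda>z. ?YF i z (z i)) \<in> borel_measurable (PiM {1..n} (\<lambda>_. P))"
      and measL: "(\<lambda>z. ?YL i z (z i)) \<in> borel_measurable (PiM {1..n} (\<lambda>_. P))"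
      and measD: "(\<lambda>z. ?YD i z (z i)) \<in> borel_measurable (PiM {1..n} (\<lambda>_. P))" if i: "i \<in> {1..n}" for i n
    proof -
      have \<delta>_comp [measurable]: "(\<lambda>z. \<delta> (z j)) \<in> borel_measurable (PiM {1..n} (\<lambda>_. P))" if "j \<in> {1..n}" for j
        using that by measurable
      note [measurable] = \<delta>_comp[OF i]
      show "(\<lambda>z. ?YF i z (z i)) \<in> borel_measurable (PiM {1..n} (\<lambda>_. P))" using i by measurable
      show "(\<lambda>z. ?YL i z (z i)) \<in> borel_measurable (PiM {1..n} (\<lambda>_. P))" by measurable
      have "(\<lambda>z. \<Sum>j\<in>{1..<i}. \<delta> (z j)) \<in> borel_measurable (PiM {1..n} (\<lambda>_. P))"
        using i by (intro borel_measurable_sum \<delta>_comp) auto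
      note [measurable] = this
      show "(\<lambda>z. ?YD i z (z i)) \<in> borel_measurable (PiM {1..n} (\<lambda>_. P))"
        unfolding u_def by measurable
    qed
    have sumF: "(\<lambda>z. \<Sum>i=1..n. ?YF i z (z i)) \<in> borel_measurable (PiM {1..n} (\<lambda>_. P))"
      and sumD: "(\<lambda>z. \<Sum>i=1..n. ?YD i z (z i)) \<in> borel_measurable (PiM {1..n} (\<lambda>_. P))"
      and sumL: "(\<lambda>z. \<Sum>i=1..n. ?YL i z (z i)) \<in> borel_measurable (PiM {1..n} (\<lambda>_. P))" for n
      using measF measD measL by (auto intro!: borel_measurable_sum)
    let ?A = "{w \<in> space M. real N * s\<^sup>2 < (\<Sum>i=1..N. ?YL i (\<lambda>t. \<xi> t w) (\<xi> i w))}"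
    let ?B = "{w \<in> space M. \<mu> * M1 * sqrt (real N) < (\<Sum>i=1..N. ?YF i (\<lambda>t. \<xi> t w) (\<xi> i w))}"
    let ?C = "{w \<in> space M. l * (2 * M2) * sqrt (real N) < (\<Sum>i=1..N. ?YD i (\<lambda>t. \<xi> t w) (\<xi> i w))}"
    have sets: "?A \<in> sets M" "?B \<in> sets M" "?C \<in> sets M"
    proof -
      note [measurable] = adapted_sum_tail(1)[OF data sumL pred(3) N]
        adapted_sum_tail(1)[OF data sumF pred(1) N] adapted_sum_tail(1)[OF data sumD pred(2) N]
      show "?A \<in> sets M" "?B \<in> sets M" "?C \<in> sets M" by measurable
    qed
    have "measure M ?A \<le> exp (real N * 1 - real N * s\<^sup>2)"
      by (rule adapted_sum_tail(2)[OF data sumL pred(3) N light_\<delta>])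
    then have A: "measure M ?A \<le> exp (- (real N * (s\<^sup>2 - 1)))" by (simp add: algebra_simps)
    have B: "measure M ?B \<le> exp (- (\<mu>\<^sup>2 / (4 * tau_star)))"
      by (rule sub_gaussian_tail[OF data measF pred(1) _ _ _ M_pos(1) N \<mu>])
        (use Gx P.prob_space light_G in \<open>auto simp: power2_commute[of "f x"]\<close>)
    have C: "measure M ?C \<le> exp (- (l\<^sup>2 / (4 * tau_star)))"
    proof (rule sub_gaussian_tail[OF data measD pred(2) _ _ _ _ N l])
      fix i and z :: "nat \<Rightarrow> real ^ 'k"
      have split: "inner (\<delta> y) (u i z) = inner (g y) (u i z) - inner h (u i z)" for y
        by (simp add: \<delta>_def inner_diff_left)
      show "integrable P (?YD i z)" unfolding split using g_int(1) by auto
      show "(LINT y|P. ?YD i z y) = 0" unfolding split using g_int P.prob_space by simp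
      have "(inner (\<delta> y) (u i z))\<^sup>2 / (2 * M2)\<^sup>2 \<le> (conj_norm nrm (\<delta> y))\<^sup>2 / M2\<^sup>2" for y
      proof -
        have "inner w (\<delta> y) \<le> 2 * conj_norm nrm (\<delta> y)" if "nrm w \<le> 2" for w
          using inner_le_conj_norm[OF nrm, of w "\<delta> y"] mult_right_mono[OF that conj_norm_nonneg[OF nrm, of "\<delta> y"]]
          by linarith
        from this[of "u i z"] this[of "- u i z"] have "\<bar>inner (\<delta> y) (u i z)\<bar> \<le> 2 * conj_norm nrm (\<delta> y)"
          using u by (simp add: n(6) inner_commute)
        then have "(inner (\<delta> y) (u i z))\<^sup>2 \<le> (2 * conj_norm nrm (\<delta> y))\<^sup>2"
          by (metis abs_ge_zero power2_abs power_mono)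
        then show ?thesis using M_pos(2) by (simp add: power_mult_distrib field_simps)
      qed
      then have "(\<integral>\<^sup>+y. ennreal (exp ((inner (\<delta> y) (u i z))\<^sup>2 / (2 * M2)\<^sup>2)) \<partial>P)
          \<le> (\<integral>\<^sup>+y. ennreal (exp ((conj_norm nrm (\<delta> y))\<^sup>2 / M2\<^sup>2)) \<partial>P)"
        by (intro nn_integral_mono ennreal_leI) simp
      with light_\<delta> show "(\<integral>\<^sup>+y. ennreal (exp ((?YD i z y)\<^sup>2 / (2 * M2)\<^sup>2)) \<partial>P) \<le> ennreal (exp 1)"
        by (rule order_trans[rotated])
    qed (use M_pos in auto)
    have "AE w in M. w \<in> ?E \<longrightarrow> w \<in> ?A \<union> ?B \<union> ?C"
      using good[of N]
    proof eventually_elim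
      case (elim w)
      let ?z = "\<lambda>t. \<xi> t w"
      let ?D = "\<Sum>t=1..N. g (\<xi> t w) - h"
      show ?case
      proof (intro impI, rule ccontr)
        assume E: "w \<in> ?E" and not: "w \<notin> ?A \<union> ?B \<union> ?C"
        have Nsq: "(sqrt (real N))\<^sup>2 = real N" "0 < sqrt (real N)" using N by auto
        have "f x - b_bound M1 M2 \<Omega> R \<mu> s l N \<le> OptN F X N ?z"
          unfolding b_bound_def
        proof (rule opt_lower_bound_of_deviations[OF Nsq(2) R M_pos(2) \<Omega> _ _ \<gamma>_def])
          have "(\<Sum>t=1..N. G x (\<xi> t w)) = (\<Sum>t=1..N. F x (\<xi> t w))"
            using elim by (intro sum.cong) (auto simp: G_def facts(1))
          then have "(\<Sum>i=1..N. f x - G x (\<xi> i w)) = real N * f x - (\<Sum>t=1..N. F x (\<xi> t w))"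
            by (simp add: sum_subtractf)
          then show "(sqrt (real N))\<^sup>2 * f x - (\<Sum>t=1..N. F x (\<xi> t w)) \<le> \<mu> * M1 * sqrt (real N)"
            using E not unfolding Nsq by (auto simp: not_less)
          show "(\<Sum>i=1..N. ?YD i ?z (\<xi> i w)) \<le> l * (2 * M2) * sqrt (real N)"
            using E not by (auto simp: not_less)
          show "(\<Sum>i=1..N. (conj_norm nrm (\<delta> (\<xi> i w)))\<^sup>2) / M2\<^sup>2 \<le> (sqrt (real N))\<^sup>2 * s\<^sup>2"
            using E not unfolding Nsq by (auto simp: not_less sum_divide_distrib)
          have "conj_norm nrm ?D \<le> \<Omega>\<^sup>2 / (2 * \<gamma>)
              + (\<Sum>i=1..N. inner (\<delta> (\<xi> i w)) (prox nrm \<omega> (\<gamma> *\<^sub>R (\<Sum>j\<in>{1..<i}. \<delta> (\<xi> j w)))))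
              + \<gamma> / 2 * (\<Sum>i=1..N. (conj_norm nrm (\<delta> (\<xi> i w)))\<^sup>2)"
            using dual_averaging_regret[OF nrm omega \<gamma>, of "\<lambda>t. \<delta> (\<xi> t w)" N]
            by (simp add: \<Omega>_def \<delta>_def)
          moreover have "(\<Sum>i=1..N. ?YD i ?z (\<xi> i w))
              = (\<Sum>i=1..N. inner (\<delta> (\<xi> i w)) (prox nrm \<omega> (\<gamma> *\<^sub>R (\<Sum>j\<in>{1..<i}. \<delta> (\<xi> j w))))) + inner ?D v"
            unfolding u_def inner_add_right sum.distrib inner_sum_left \<delta>_def ..
          ultimately show "conj_norm nrm ?D + inner ?D v \<le> \<Omega>\<^sup>2 / (2 * \<gamma>)
              + (\<Sum>i=1..N. ?YD i ?z (\<xi> i w)) + \<gamma> / 2 * (\<Sum>i=1..N. (conj_norm nrm (\<delta> (\<xi> i w)))\<^sup>2)"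
            by linarith
          have "inner ?D (x - c) = R * inner ?D v" unfolding v(2)[symmetric] by simp
          then have "(\<Sum>t=1..N. F x (\<xi> t w)) - R * (conj_norm nrm ?D + inner ?D v)
              = (\<Sum>t=1..N. F x (\<xi> t w)) - (R * conj_norm nrm ?D + inner ?D (x - c))"
            by (simp only: distrib_left)
          also have "\<dots> \<le> real N * OptN F X N ?z"
            using elim by (intro OptN_lower_bound nrm X(1) N c gradient_at_minimum[OF X(2) x(1) _ x(3) f_conv h(1)]) auto
          finally show "(\<Sum>t=1..N. F x (\<xi> t w)) - R * (conj_norm nrm ?D + inner ?D v)
              \<le> (sqrt (real N))\<^sup>2 * OptN F X N ?z" unfolding Nsq .
        qed
        then show False using E x(2) by auto
      qed
    qed
    from prob_le_of_AE_cover3[OF M sets this A B C] show ?thesis .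
  qed
  show ?thesis using upper lower unfolding \<Omega>_def R_def by blast
qed

end
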